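(* There exists a conformal minimal immersion $X=(X_1,X_2,X_3):\overline{\mathbb{D}}_+\to\mathbb{R}^3$ such that $(X_1,X_3):\overline{\mathbb{D}}_+\to\mathbb{R}^2$ is proper and $$\lim_{n\to\infty}\min\Big\{\frac{X_3(p_n)}{|X_1(p_n)|+1},\,0\Big\}=0$$ for every divergent sequence $\{p_n\}_{n\in\mathbb{N}}$ in $\overline{\mathbb{D}}_+$.
   Context: $\overline{\mathbb{D}}$ is the closed unit disc in $\mathbb{C}$ and $\overline{\mathbb{D}}_+:=\overline{\mathbb{D}}\cap\{z\in\mathbb{C}\mid \mathrm{Im}(z)>0\}$, viewed as a Riemann surface with non-empty boundary. A sequence in $\overline{\mathbb{D}}_+$ is divergent if it eventually leaves every compact subset of $\overline{\mathbb{D}}_+$. *)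

theory Defs
  imports "HOL-Analysis.Analysis"
begin

definition half_disc :: "complex set" where
  "half_disc = cball 0 1 \<inter> {z. Im z > 0}"

definition divergent_in :: "'a::topological_space set \<Rightarrow> (nat \<Rightarrow> 'a) \<Rightarrow> bool" where
  "divergent_in S p \<longleftrightarrow> (\<forall>n. p n \<in> S) \<and>
     (\<forall>K. compact K \<and> K \<subseteq> S \<longrightarrow> (\<forall>\<^sub>F n in sequentially. p n \<notin> K))"

definition proper_on :: "'a::topological_space set \<Rightarrow> ('a \<Rightarrow> 'b::topological_space) \<Rightarrow> bool" where
  "proper_on S f \<longleftrightarrow> continuous_on S f \<and> (\<forall>K. compact K \<longrightarrow> compact (S \<inter> f -` K))"

text \<open>Partial derivatives with respect to the coordinate \<open>z = u + \<i> v\<close>.\<close>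

definition du :: "(complex \<Rightarrow> 'a::real_normed_vector) \<Rightarrow> complex \<Rightarrow> 'a" where
  "du f z = frechet_derivative f (at z) 1"

definition dv :: "(complex \<Rightarrow> 'a::real_normed_vector) \<Rightarrow> complex \<Rightarrow> 'a" where
  "dv f z = frechet_derivative f (at z) \<i>"

text \<open>Only meaningful for open \<open>U\<close>: the derivatives are taken in the whole plane.\<close>

fun Ck_on :: "nat \<Rightarrow> complex set \<Rightarrow> (complex \<Rightarrow> 'a::real_normed_vector) \<Rightarrow> bool" where
  "Ck_on 0 U f \<longleftrightarrow> continuous_on U f"
| "Ck_on (Suc k) U f \<longleftrightarrow> (\<forall>z\<in>U. f differentiable (at z)) \<and> Ck_on k U (du f) \<and> Ck_on k U (dv f)"

definition smooth_on :: "complex set \<Rightarrow> (complex \<Rightarrow> 'a::real_normed_vector) \<Rightarrow> bool" where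
  "smooth_on U f \<longleftrightarrow> (\<forall>k. Ck_on k U f)"

definition immersion_at :: "(complex \<Rightarrow> real^3) \<Rightarrow> complex \<Rightarrow> bool" where
  "immersion_at X z \<longleftrightarrow> inj (frechet_derivative X (at z))"

definition conformal_at :: "(complex \<Rightarrow> real^3) \<Rightarrow> complex \<Rightarrow> bool" where
  "conformal_at X z \<longleftrightarrow> (\<exists>c>0. \<forall>v w.
     frechet_derivative X (at z) v \<bullet> frechet_derivative X (at z) w = c * (v \<bullet> w))"

definition unit_normal :: "(complex \<Rightarrow> real^3) \<Rightarrow> complex \<Rightarrow> real^3" where
  "unit_normal X z = sgn (cross3 (du X z) (dv X z))"

text \<open>The classical formula \<open>H = (e G - 2 f F + g E) / (2 (E G - F\<^sup>2))\<close> in terms of the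
  coefficients of the first and second fundamental forms.\<close>

definition mean_curvature :: "(complex \<Rightarrow> real^3) \<Rightarrow> complex \<Rightarrow> real" where
  "mean_curvature X z =
    (let E = du X z \<bullet> du X z; F = du X z \<bullet> dv X z; G = dv X z \<bullet> dv X z;
         N = unit_normal X z;
         e = du (du X) z \<bullet> N; f = dv (du X) z \<bullet> N; g = dv (dv X) z \<bullet> N
     in (e * G - 2 * f * F + g * E) / (2 * (E * G - F\<^sup>2)))"

text \<open>\<open>S\<close> is a planar surface, possibly with boundary, whose interior is dense in it. As usual on
  surfaces with boundary, smoothness means having a smooth extension \<open>Y\<close> to an open neighbourhood;
  the derivatives of \<open>Y\<close> at points of \<open>S\<close>, boundary points included, do not depend on the choice
  of \<open>Y\<close>. No condition is put on \<open>Y\<close> outside \<open>S\<close>.\<close>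

definition conformal_minimal_immersion_on :: "complex set \<Rightarrow> (complex \<Rightarrow> real^3) \<Rightarrow> bool" where
  "conformal_minimal_immersion_on S X \<longleftrightarrow>
    (\<exists>U Y. open U \<and> S \<subseteq> U \<and> smooth_on U Y \<and> (\<forall>z\<in>S. Y z = X z) \<and>
       (\<forall>z\<in>S. immersion_at Y z \<and> conformal_at Y z \<and> mean_curvature Y z = 0))"

end

(*
  Conformal minimal immersions of simply connected domains are X = Re F for holomorphic F with
  F1'^2 + F2'^2 + F3'^2 = 0 and F' nowhere zero. Such null data stay null and nonvanishing when they
  are rotated by a holomorphic complex angle theta about a real axis, and the component of X along
  the axis does not change at all.

  In stage k the axis is the normal (-sin a_k, 0, cos a_k) of a line of slope tan a_k in the
  (x1,x3)-plane, where a_k = 1/(k+1), and theta is tiny except in the strip between the heights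
  1/(k+2) and 1/(k+1). By a Runge argument theta can be chosen so that everything below the strip is
  moved very far along the line, to the right and upwards. The next line is less steep, so below the
  strip the component along the next normal has become large. Inside the strip X itself is
  uncontrolled, but its component along the normal is still the large one from before the stage. Hence on the k-th strip the limit satisfies cos a_k X3 - sin a_k X1 >= k - 2, which gives both
  properness and the lower bound -tan a_k |X1| for X3. The strips may reach the boundary arc
  because the construction is carried out on the larger half disc of radius 2.
*)

theory Submission
  imports Defs "HOL-Complex_Analysis.Complex_Analysis"
begin

section \<open>Approximation by entire functions\<close>

text \<open>The uniform closure on \<open>K\<close> of the entire functions. Inside this closure
  poles can be moved by products and geometric series alone.\<close>

definition entire_approx :: "complex set \<Rightarrow> (complex \<Rightarrow> complex) \<Rightarrow> bool" where
  "entire_approx K f \<longleftrightarrow>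
     (\<forall>e>0. \<exists>g. g holomorphic_on UNIV \<and> (\<forall>z\<in>K. norm (g z - f z) < e))"

lemma entire_approxD:
  assumes "entire_approx K f" "e > 0"
  obtains g where "g holomorphic_on UNIV" "\<And>z. z \<in> K \<Longrightarrow> norm (g z - f z) < e"
  using assms unfolding entire_approx_def by blast

lemma entire_approx_holomorphic:
  assumes "f holomorphic_on UNIV"
  shows "entire_approx K f"
  unfolding entire_approx_def using assms by (intro allI impI exI[of _ f]) auto

text \<open>The error splits as \<open>(f1 z - f z) * g1 z + f z * (g1 z - g z)\<close>; the common
  bound \<open>B\<close> controls the factor beside each small difference.\<close>

lemma entire_approx_mult:
  assumes f: "entire_approx K f" and g: "entire_approx K g"
    and bf: "\<And>z. z \<in> K \<Longrightarrow> norm (f z) \<le> B" and bg: "\<And>z. z \<in> K \<Longrightarrow> norm (g z) \<le> B"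
  shows "entire_approx K (\<lambda>z. f z * g z)"
  unfolding entire_approx_def
proof (intro allI impI)
  fix e :: real assume e: "e > 0"
  define C where "C = \<bar>B\<bar> + 1"
  \<comment> \<open>The bound 1 keeps \<open>g1\<close> below \<open>C\<close>; the other bound
    makes each of the two error terms less than \<open>e / 2\<close>.\<close>
  define d where "d = min 1 (e / (2 * C))"
  have C: "C > 0" "B \<le> C" by (auto simp: C_def)
  have d: "d > 0" "d \<le> 1" "d * C \<le> e / 2" using e C by (auto simp: d_def min_def field_simps)
  obtain f1 where f1: "f1 holomorphic_on UNIV" "\<And>z. z \<in> K \<Longrightarrow> norm (f1 z - f z) < d"
    using entire_approxD[OF f d(1)] by blast
  obtain g1 where g1: "g1 holomorphic_on UNIV" "\<And>z. z \<in> K \<Longrightarrow> norm (g1 z - g z) < d"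
    using entire_approxD[OF g d(1)] by blast
  have "norm (f1 z * g1 z - f z * g z) < e" if z: "z \<in> K" for z
  proof -
    have "norm (g1 z) \<le> norm (g z) + norm (g1 z - g z)" by (rule norm_triangle_sub)
    then have n1: "norm (g1 z) \<le> C" using bg[OF z] g1(2)[OF z] d by (auto simp: C_def)
    have "f1 z * g1 z - f z * g z = (f1 z - f z) * g1 z + f z * (g1 z - g z)"
      by (simp add: algebra_simps)
    then have "norm (f1 z * g1 z - f z * g z)
        \<le> norm (f1 z - f z) * norm (g1 z) + norm (f z) * norm (g1 z - g z)"
      by (metis norm_mult norm_triangle_ineq)
    also have "\<dots> \<le> norm (f1 z - f z) * C + C * norm (g1 z - g z)"
      using n1 bf[OF z] C by (intro add_mono mult_mono) auto
    also have "\<dots> < d * C + C * d"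
      using C f1(2)[OF z] g1(2)[OF z] by (intro add_strict_mono) auto
    also have "\<dots> \<le> e" using d by (simp add: mult.commute)
    finally show ?thesis .
  qed
  then show "\<exists>h. h holomorphic_on UNIV \<and> (\<forall>z\<in>K. norm (h z - f z * g z) < e)"
    by (intro exI[of _ "\<lambda>z. f1 z * g1 z"]) (auto intro!: holomorphic_intros f1 g1)
qed

text \<open>A partial sum of the geometric series in an entire approximation of \<open>w\<close> is
  again entire. The bound \<open>1 / 2\<close> leaves room for that approximation to stay well
  inside the unit disc.\<close>

lemma entire_approx_geometric:
  assumes w: "entire_approx K w" and half: "\<And>z. z \<in> K \<Longrightarrow> norm (w z) \<le> 1 / 2"
  shows "entire_approx K (\<lambda>z. 1 / (1 - w z))"
  unfolding entire_approx_def
proof (intro allI impI)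
  fix e :: real assume e: "e > 0"
  \<comment> \<open>The bound \<open>1 / 4\<close> gives \<open>norm (v z) \<le> 3 / 4\<close>,
    hence a truncation error of at most \<open>4 * (3 / 4) ^ n\<close>. Replacing \<open>v\<close>
    by \<open>w\<close> costs at most \<open>8 * d\<close>.\<close>
  define d where "d = min (1 / 4) (e / 32)"
  have d: "d > 0" "d \<le> 1 / 4" "8 * d \<le> e / 4" using e by (auto simp: d_def)
  obtain v where v: "v holomorphic_on UNIV" "\<And>z. z \<in> K \<Longrightarrow> norm (v z - w z) < d"
    using entire_approxD[OF w d(1)] by blast
  have "(\<lambda>n. 4 * (3 / 4 :: real) ^ n) \<longlonglongrightarrow> 4 * 0"
    by (intro tendsto_intros LIMSEQ_realpow_zero) auto
  then have "eventually (\<lambda>n. 4 * (3 / 4 :: real) ^ n < e / 2) sequentially"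
    by (rule order_tendstoD) (use e in auto)
  then obtain n where n: "4 * (3 / 4 :: real) ^ n < e / 2"
    by (auto simp: eventually_sequentially)
  have "norm ((\<Sum>i<n. v z ^ i) - 1 / (1 - w z)) < e" if z: "z \<in> K" for z
  proof -
    have "norm (v z) \<le> norm (w z) + norm (v z - w z)" by (rule norm_triangle_sub)
    then have nv: "norm (v z) \<le> 3 / 4" using half[OF z] v(2)[OF z] d by auto
    have a: "norm (1 - v z) \<ge> 1 / 4"
      using norm_triangle_ineq2[of 1 "v z"] nv by simp
    have b: "norm (1 - w z) \<ge> 1 / 2"
      using norm_triangle_ineq2[of 1 "w z"] half[OF z] by simp
    have ne: "1 - v z \<noteq> 0" "1 - w z \<noteq> 0" using a b by auto
    have S: "(\<Sum>i<n. v z ^ i) = (1 - v z ^ n) / (1 - v z)"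
      using ne by (simp add: one_diff_power_eq)
    have "(\<Sum>i<n. v z ^ i) - 1 / (1 - w z)
        = - (v z ^ n / (1 - v z)) + (v z - w z) / ((1 - v z) * (1 - w z))"
      unfolding S using ne by (simp add: divide_simps) (simp add: algebra_simps)
    then have "norm ((\<Sum>i<n. v z ^ i) - 1 / (1 - w z))
        \<le> norm (v z ^ n / (1 - v z)) + norm ((v z - w z) / ((1 - v z) * (1 - w z)))"
      by (metis norm_minus_cancel norm_triangle_ineq)
    also have "norm (v z ^ n / (1 - v z)) \<le> (3 / 4) ^ n / (1 / 4)"
      unfolding norm_divide norm_power using nv a by (intro frac_le power_mono) auto
    also have "norm ((v z - w z) / ((1 - v z) * (1 - w z))) \<le> d / ((1 / 4) * (1 / 2))"
      unfolding norm_divide norm_mult using v(2)[OF z] a b d by (intro frac_le mult_mono) auto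
    finally show ?thesis using n d by simp
  qed
  then show "\<exists>h. h holomorphic_on UNIV \<and> (\<forall>z\<in>K. norm (h z - 1 / (1 - w z)) < e)"
    by (intro exI[of _ "\<lambda>z. \<Sum>i<n. v z ^ i"]) (auto intro!: holomorphic_intros v)
qed

lemma norm_inverse_one_minus_le:
  fixes w :: complex
  assumes "norm w \<le> 1 / 2"
  shows "norm (1 / (1 - w)) \<le> 2"
proof -
  have "norm (1 - w) \<ge> 1 / 2" using norm_triangle_ineq2[of 1 w] assms by simp
  then have "1 / norm (1 - w) \<le> 1 / (1 / 2)" by (intro frac_le) auto
  then show ?thesis by (simp add: norm_divide)
qed

text \<open>Expand in powers of \<open>z / q\<close>, which has modulus at most \<open>1 / 2\<close>
  on \<open>K\<close>: the function is \<open>- 1 / q\<close> times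
  \<open>1 / (1 - z / q)\<close>.\<close>

lemma entire_approx_pole_far:
  assumes "\<And>z. z \<in> K \<Longrightarrow> norm z \<le> R" "2 * R \<le> norm q" "q \<noteq> 0"
  shows "entire_approx K (\<lambda>z. 1 / (z - q))"
proof -
  have h: "norm (z / q) \<le> 1 / 2" if "z \<in> K" for z
    using assms that by (force simp: norm_divide field_simps)
  have b: "norm (1 / (1 - z / q)) \<le> 2" if "z \<in> K" for z
    by (rule norm_inverse_one_minus_le[OF h[OF that]])
  have 1: "entire_approx K (\<lambda>z. 1 / (1 - z / q))"
    by (rule entire_approx_geometric[OF entire_approx_holomorphic h])
       (auto intro!: holomorphic_intros simp: assms)
  have "entire_approx K (\<lambda>z. (- 1 / q) * (1 / (1 - z / q)))"
    by (rule entire_approx_mult[OF _ 1, where B = "max 2 (norm (- 1 / q))"])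
       (auto intro!: entire_approx_holomorphic max.coboundedI1 b simp del: times_divide_eq_left)
  moreover have "(- 1 / q) * (1 / (1 - z / q)) = 1 / (z - q)" for z
  proof -
    have "(1 - z / q) * q = q - z" using assms(3) by (simp add: field_simps)
    then have "(- 1 / q) * (1 / (1 - z / q)) = - 1 / (q - z)"
      by (simp add: divide_simps mult.commute)
    then show ?thesis by (metis minus_diff_eq minus_divide_divide minus_minus)
  qed
  ultimately show ?thesis by simp
qed

text \<open>With \<open>w = (q' - q) / (z - q)\<close> one has
  \<open>1 / (z - q') = (1 / (z - q)) * (1 / (1 - w))\<close>, and a move by at most half of the
  separation \<open>r\<close> makes \<open>norm w \<le> 1 / 2\<close> on \<open>K\<close>.\<close>

lemma entire_approx_pole_shift:
  assumes q: "entire_approx K (\<lambda>z. 1 / (z - q))"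
    and r: "r > 0" "\<And>z. z \<in> K \<Longrightarrow> r \<le> norm (z - q)" and q': "norm (q' - q) \<le> r / 2"
  shows "entire_approx K (\<lambda>z. 1 / (z - q'))"
proof -
  have b: "norm (1 / (z - q)) \<le> 1 / r" if "z \<in> K" for z
    unfolding norm_divide using r that by (auto intro!: frac_le)
  have w: "norm ((q' - q) * (1 / (z - q))) \<le> 1 / 2" if "z \<in> K" for z
  proof -
    have "norm ((q' - q) * (1 / (z - q))) \<le> (r / 2) * (1 / r)"
      unfolding norm_mult using b[OF that] q' r by (intro mult_mono) auto
    then show ?thesis using r by simp
  qed
  have 1: "entire_approx K (\<lambda>z. (q' - q) * (1 / (z - q)))"
    by (rule entire_approx_mult[OF _ q, where B = "max (1 / r) (norm (q' - q))"])
       (use b in \<open>force intro!: entire_approx_holomorphic simp: le_max_iff_disj\<close>)+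
  have 2: "entire_approx K (\<lambda>z. 1 / (1 - (q' - q) * (1 / (z - q))))"
    by (rule entire_approx_geometric[OF 1 w])
  have b2: "norm (1 / (1 - (q' - q) * (1 / (z - q)))) \<le> 2" if "z \<in> K" for z
    by (rule norm_inverse_one_minus_le[OF w[OF that]])
  have "entire_approx K (\<lambda>z. (1 / (z - q)) * (1 / (1 - (q' - q) * (1 / (z - q)))))"
    by (rule entire_approx_mult[OF q 2, where B = "max (1 / r) 2"])
       (use b b2 in \<open>force simp: le_max_iff_disj\<close>)+
  moreover have "(1 / (z - q)) * (1 / (1 - (q' - q) * (1 / (z - q)))) = 1 / (z - q')" if "z \<in> K" for z
  proof -
    have ne: "z - q \<noteq> 0" using r(1) r(2)[OF that] by auto
    then have "(z - q) * (1 - (q' - q) * (1 / (z - q))) = z - q'"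
      by (simp add: field_simps)
    then show ?thesis by (metis mult.right_neutral times_divide_times_eq)
  qed
  ultimately show ?thesis by (simp add: entire_approx_def)
qed

text \<open>The ray has positive distance from the compact set \<open>K\<close>, so finitely many
  short shifts bring the pole from a remote point of the ray to \<open>p\<close>.\<close>

lemma entire_approx_pole_ray:
  assumes K: "compact K" and d: "d \<noteq> 0" and ray: "\<And>x::real. x \<ge> 0 \<Longrightarrow> p + of_real x * d \<notin> K"
  shows "entire_approx K (\<lambda>z. 1 / (z - p))"
proof -
  define L where "L = (\<lambda>x::real. p + of_real x * d) ` {0..}"
  \<comment> \<open>The ray is closed, being the preimage of the nonnegative real half-line under an
    affine map.\<close>
  have "closed ((\<lambda>z. (z - p) / d) -` {z. Re z \<ge> 0 \<and> Im z = 0})"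
    by (intro closed_vimage continuous_intros closed_Collect_conj closed_Collect_le closed_Collect_eq)
       (use d in auto)
  moreover have "(\<lambda>z. (z - p) / d) -` {z. Re z \<ge> 0 \<and> Im z = 0} = L"
  proof (intro set_eqI iffI)
    fix z assume "z \<in> (\<lambda>z. (z - p) / d) -` {z. Re z \<ge> 0 \<and> Im z = 0}"
    then have "Re ((z - p) / d) \<ge> 0" "(z - p) / d = of_real (Re ((z - p) / d))"
      by (auto simp: complex_eq_iff)
    moreover have "z = p + (z - p) / d * d" using d by simp
    ultimately show "z \<in> L" unfolding L_def by (intro image_eqI[of _ _ "Re ((z - p) / d)"]) auto
  qed (use d in \<open>auto simp: L_def\<close>)
  ultimately have "closed L" by simp
  moreover have "K \<inter> L = {}" using ray by (auto simp: L_def)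
  ultimately have "\<exists>r>0. \<forall>z\<in>K. \<forall>q\<in>L. r \<le> dist z q"
    by (intro separate_compact_closed K)
  then obtain r where r: "r > 0" "\<And>z q. z \<in> K \<Longrightarrow> q \<in> L \<Longrightarrow> r \<le> dist z q"
    by blast
  obtain R where R: "\<And>z. z \<in> K \<Longrightarrow> norm z \<le> R"
    using compact_imp_bounded[OF K] bounded_iff by blast
  \<comment> \<open>Chosen so that consecutive points \<open>q n\<close> are exactly
    \<open>r / 2\<close> apart.\<close>
  define h where "h = r / (2 * norm d)"
  have h: "h > 0" using r d by (simp add: h_def)
  define q where "q n = p + of_real (real n * h) * d" for n
  have qL: "q n \<in> L" for n unfolding q_def L_def using h by (intro imageI) simp
  have step: "norm (q n - q (Suc n)) \<le> r / 2" for n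
  proof -
    have "q n - q (Suc n) = - (of_real h * d)" by (simp add: q_def algebra_simps)
    then have "norm (q n - q (Suc n)) = h * norm d" using h by (simp add: norm_mult)
    then show ?thesis using d by (simp add: h_def)
  qed
  obtain N where N: "real N * (h * norm d) > max 0 (2 * R) + norm p"
    using h d ex_less_of_nat_mult[of "h * norm d"] by auto
  have "norm (of_real (real N * h) * d) \<le> norm (q N) + norm p"
    unfolding q_def by (metis add.commute add_diff_cancel_left' norm_triangle_ineq4)
  moreover have "norm (of_real (real N * h) * d) = real N * (h * norm d)"
    using h by (simp add: norm_mult)
  ultimately have qN: "norm (q N) > max 0 (2 * R)" using N by linarith
  have far: "entire_approx K (\<lambda>z. 1 / (z - q N))"
    by (rule entire_approx_pole_far[OF R]) (use qN in auto)
  \<comment> \<open>Induction on the number \<open>j\<close> of steps back from \<open>q N\<close>;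
    at \<open>j = N\<close> the pole sits at \<open>q 0 = p\<close>.\<close>
  have "entire_approx K (\<lambda>z. 1 / (z - q (N - j)))" if "j \<le> N" for j
    using that
  proof (induction j)
    case 0
    then show ?case using far by simp
  next
    case (Suc j)
    then have IH: "entire_approx K (\<lambda>z. 1 / (z - q (N - j)))" by simp
    have e: "N - j = Suc (N - Suc j)" using Suc.prems by simp
    show ?case
    proof (rule entire_approx_pole_shift[OF IH r(1)])
      show "norm (q (N - Suc j) - q (N - j)) \<le> r / 2" unfolding e by (rule step)
    qed (use r(2)[OF _ qL] in \<open>simp add: dist_norm\<close>)
  qed
  from this[of N] show ?thesis by (simp add: q_def)
qed

section \<open>Large displacements from Cauchy's inequality\<close>

text \<open>The integral is an entire function \<open>I\<close> of \<open>\<zeta>\<close> with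
  \<open>I 0 = 0\<close> and derivative \<open>- c\<close> at 0. If
  \<open>Re (I \<zeta>) \<le> T\<close> held on the disc of radius \<open>\<rho>\<close>, Cauchy's
  inequality for \<open>exp (I \<zeta>)\<close> would give
  \<open>norm c \<le> exp T / \<rho>\<close>.\<close>

lemma cosine_gain:
  fixes u v g :: "real \<Rightarrow> complex"
  assumes cont: "continuous_on {0..1} u" "continuous_on {0..1} v" "continuous_on {0..1} g"
    and c: "c = integral {0..1} (\<lambda>t. v t * g t)"
    and \<rho>: "\<rho> > 0" "exp T < \<rho> * norm c"
  shows "\<exists>\<zeta>. norm \<zeta> \<le> \<rho> \<and>
    Re (integral {0..1} (\<lambda>t. u t * (cos (\<zeta> * g t) - 1) - v t * sin (\<zeta> * g t))) > T"
proof (rule ccontr)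
  define I where "I \<zeta> = integral (cbox 0 1) (\<lambda>t. u t * (cos (\<zeta> * g t) - 1) - v t * sin (\<zeta> * g t))" for \<zeta>
  assume "\<not> ?thesis"
  then have le: "Re (I \<zeta>) \<le> T" if "norm \<zeta> \<le> \<rho>" for \<zeta>
    using that by (force simp: I_def not_less cbox_interval)
  have c2: "continuous_on (UNIV \<times> {0..1}) (\<lambda>x. f (snd x))" if "continuous_on {0..1} f"
    for f :: "real \<Rightarrow> complex"
    by (rule continuous_on_compose2[OF that]) (auto intro!: continuous_intros)
  have D: "(I has_field_derivative
      integral (cbox 0 1) (\<lambda>t. - u t * g t * sin (\<zeta> * g t) - v t * g t * cos (\<zeta> * g t))) (at \<zeta>)" for \<zeta>
    unfolding I_def
  proof (rule leibniz_rule_field_derivative[where U = UNIV])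
    show "((\<lambda>\<zeta>. u t * (cos (\<zeta> * g t) - 1) - v t * sin (\<zeta> * g t)) has_field_derivative
        - u t * g t * sin (\<zeta> * g t) - v t * g t * cos (\<zeta> * g t)) (at \<zeta> within UNIV)" for \<zeta> t
      by (auto intro!: derivative_eq_intros simp: algebra_simps)
    show "(\<lambda>t. u t * (cos (\<zeta> * g t) - 1) - v t * sin (\<zeta> * g t)) integrable_on cbox 0 1" for \<zeta>
      unfolding cbox_interval
      by (intro integrable_continuous_interval continuous_intros cont)
    show "continuous_on (UNIV \<times> cbox 0 1) (\<lambda>(\<zeta>, t). - u t * g t * sin (\<zeta> * g t) - v t * g t * cos (\<zeta> * g t))"
      unfolding cbox_interval split_beta
      by (intro continuous_intros c2 cont)
  qed auto
  \<comment> \<open>Exponentiation turns the one-sided bound on the real part into a bound on the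
    modulus.\<close>
  define E where "E = (\<lambda>\<zeta>. exp (I \<zeta>))"
  have DE: "(E has_field_derivative exp (I \<zeta>) *
      integral (cbox 0 1) (\<lambda>t. - u t * g t * sin (\<zeta> * g t) - v t * g t * cos (\<zeta> * g t))) (at \<zeta>)" for \<zeta>
    unfolding E_def by (rule DERIV_fun_exp[OF D])
  have hol: "E holomorphic_on S" for S
    unfolding holomorphic_on_def field_differentiable_def
    by (intro ballI exI, rule has_field_derivative_at_within, rule DE)
  have I0: "I 0 = 0" by (simp add: I_def)
  have "deriv E 0 = - c"
    using DERIV_imp_deriv[OF DE[of 0]] by (simp add: I0 c cbox_interval)
  moreover have "norm ((deriv ^^ 1) E 0) \<le> fact 1 * exp T / \<rho> ^ 1"
    by (rule Cauchy_inequality[OF hol holomorphic_on_imp_continuous_on[OF hol] \<rho>(1)])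
       (use le in \<open>auto simp: E_def\<close>)
  ultimately show False using \<rho> by (simp add: field_simps)
qed

section \<open>Primitives and integrals across a strip\<close>

lemma entire_primitive:
  assumes "f holomorphic_on UNIV"
  obtains F where "\<And>z. (F has_field_derivative f z) (at z)" "F a = (0::complex)"
proof -
  obtain G where G: "\<And>z. (G has_field_derivative f z) (at z)"
    using holomorphic_convex_primitive'[OF convex_UNIV open_UNIV assms] by auto
  show ?thesis
    by (rule that[of "\<lambda>z. G z - G a"]) (auto intro!: derivative_eq_intros G)
qed

text \<open>The velocity of \<open>c\<close> is \<open>\<i> * (c t - p)\<close>, which cancels the
  pole: where \<open>g\<close> is close to \<open>1 / (z - p)\<close>, the integrand is close to
  \<open>\<i> * m (c t)\<close>. The path starts below \<open>p\<close>, climbs on the right up to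
  \<open>t = pi\<close>, and then descends on the left.\<close>

lemma arc_integral:
  assumes a: "0 \<le> a" "a \<le> b" and d: "\<delta> > 0"
    and m: "m holomorphic_on UNIV" and M: "\<And>z. z \<in> sphere p \<delta> \<Longrightarrow> norm (m z) \<le> M"
    and c: "\<And>t. c t = p - \<i> * of_real \<delta> * cis t"
    and g: "\<And>t. t \<in> {a..b} \<Longrightarrow> norm (g (c t) - 1 / (c t - p)) \<le> e"
    and \<Phi>: "\<And>z. (\<Phi> has_field_derivative m z * g z) (at z)"
    and e: "e \<ge> 0"
  shows "norm (\<Phi> (c b) - \<Phi> (c a) - integral {a..b} (\<lambda>t. \<i> * m (c t))) \<le> M * e * \<delta> * (b - a)"
proof -
  have cp: "norm (c t - p) = \<delta>" "c t - p \<noteq> 0" "c t \<in> sphere p \<delta>" for t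
    using d by (auto simp: c norm_mult dist_norm)
  have vd: "((\<lambda>t. \<Phi> (c t)) has_vector_derivative (\<i> * (c t - p)) * (m (c t) * g (c t))) (at t within {a..b})" for t
  proof -
    have "(c has_vector_derivative \<i> * (c t - p)) (at t within {a..b})"
      unfolding c[abs_def] cis_conv_exp
      by (rule has_vector_derivative_real_field[where f = "\<lambda>z. p - \<i> * of_real \<delta> * exp (\<i> * z)"])
         (auto intro!: derivative_eq_intros simp: algebra_simps)
    from field_vector_diff_chain_within[OF this, of \<Phi>, OF has_field_derivative_at_within[OF \<Phi>]]
    show ?thesis by (simp add: o_def mult.commute)
  qed
  have 1: "((\<lambda>t. (\<i> * (c t - p)) * (m (c t) * g (c t))) has_integral (\<Phi> (c b) - \<Phi> (c a))) {a..b}"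
    by (rule fundamental_theorem_of_calculus[OF a(2) vd])
  have cont: "continuous_on {a..b} (\<lambda>t. m (c t))"
    by (rule continuous_on_compose2[OF holomorphic_on_imp_continuous_on[OF m]])
       (auto simp: c[abs_def] intro!: continuous_intros)
  have 2: "((\<lambda>t. \<i> * m (c t)) has_integral integral {a..b} (\<lambda>t. \<i> * m (c t))) {a..b}"
    by (intro integrable_integral integrable_continuous_interval continuous_intros cont)
  have M0: "M \<ge> 0" using M[OF cp(3)[of 0]] norm_ge_zero order_trans by blast
  have "norm (\<Phi> (c b) - \<Phi> (c a) - integral {a..b} (\<lambda>t. \<i> * m (c t)))
      \<le> (M * e * \<delta>) * measure lborel (cbox a b)"
  proof (rule has_integral_bound[of _ "\<lambda>t. (\<i> * (c t - p)) * (m (c t) * g (c t)) - \<i> * m (c t)"])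
    show "((\<lambda>t. (\<i> * (c t - p)) * (m (c t) * g (c t)) - \<i> * m (c t)) has_integral
        (\<Phi> (c b) - \<Phi> (c a) - integral {a..b} (\<lambda>t. \<i> * m (c t)))) (cbox a b)"
      unfolding cbox_interval by (rule has_integral_diff[OF 1 2])
    fix t assume t: "t \<in> cbox a b"
    have "(\<i> * (c t - p)) * (m (c t) * g (c t)) - \<i> * m (c t)
        = (\<i> * m (c t)) * ((g (c t) - 1 / (c t - p)) * (c t - p))"
      using cp(2) by (simp add: algebra_simps)
    then have "norm ((\<i> * (c t - p)) * (m (c t) * g (c t)) - \<i> * m (c t))
        = norm (m (c t)) * (norm (g (c t) - 1 / (c t - p)) * \<delta>)"
      by (simp add: norm_mult cp(1))
    also have "\<dots> \<le> M * (e * \<delta>)"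
      using M[OF cp(3)] g[of t] t d e M0 by (intro mult_mono) (auto simp: cbox_interval)
    finally show "norm ((\<i> * (c t - p)) * (m (c t) * g (c t)) - \<i> * m (c t)) \<le> M * e * \<delta>"
      by (simp add: mult.assoc)
  qed (use M0 e d in auto)
  then show ?thesis using a by simp
qed

text \<open>The function is the difference of two entire approximations of \<open>1 / (z - p)\<close> on \<open>K\<close>: the pole
  of one is pushed to infinity to the left, that of the other to the right. On \<open>K\<close> they nearly
  agree, but integrating \<open>m\<close> against them across the strip, passing \<open>p\<close> on the right or on the left
  respectively, makes the difference a full residue.\<close>

lemma entire_small_off_strip:
  assumes m: "m holomorphic_on UNIV" "m p \<noteq> 0" and K: "compact K" and d: "\<delta> > 0"
    and strip: "\<And>z. z \<in> K \<Longrightarrow> \<bar>Im z - Im p\<bar> \<ge> \<delta>" and \<eta>: "\<eta> > 0"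
  obtains g where "g holomorphic_on UNIV" "\<And>z. z \<in> K \<Longrightarrow> norm (g z) < \<eta>"
    "\<And>\<Phi>. (\<And>z. (\<Phi> has_field_derivative m z * g z) (at z)) \<Longrightarrow>
       norm (\<Phi> (p + \<i> * of_real \<delta>) - \<Phi> (p - \<i> * of_real \<delta>)) \<ge> norm (m p)"
proof -
  define c where "c t = p - \<i> * of_real \<delta> * cis t" for t
  have cont: "continuous_on S c" for S unfolding c_def by (intro continuous_intros)
  have Re_c: "Re (c t) = Re p + \<delta> * sin t" "Im (c t) = Im p - \<delta> * cos t" for t
    by (simp_all add: c_def)
  \<comment> \<open>The ray stays at the height of \<open>p\<close>. So it misses \<open>K\<close>,
    and it could meet the arc only where \<open>cos t = 0\<close>, which the sign condition
    excludes.\<close>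
  have off: "p + of_real x * of_real \<sigma> \<notin> K \<union> c ` {a..b}"
    if x: "x \<ge> 0" and \<sigma>: "\<sigma> \<noteq> 0" and sg: "\<And>t. t \<in> {a..b} \<Longrightarrow> \<sigma> * sin t \<le> 0" for x \<sigma> a b :: real
  proof
    assume "p + of_real x * of_real \<sigma> \<in> K \<union> c ` {a..b}"
    then show False
    proof
      assume "p + of_real x * of_real \<sigma> \<in> K"
      from strip[OF this] show False using d by simp
    next
      assume "p + of_real x * of_real \<sigma> \<in> c ` {a..b}"
      then obtain t where t: "t \<in> {a..b}" "p + of_real x * of_real \<sigma> = c t" by auto
      have "x * \<sigma> = \<delta> * sin t" "cos t = 0"
        using arg_cong[OF t(2), of Re] arg_cong[OF t(2), of Im] d by (auto simp: Re_c)
      moreover from \<open>cos t = 0\<close> have "sin t \<noteq> 0" using sin_zero_abs_cos_one[of t] by auto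
      moreover have "(\<sigma> * \<sigma>) * x = \<delta> * (\<sigma> * sin t)" using \<open>x * \<sigma> = \<delta> * sin t\<close> by (simp add: ac_simps)
      moreover have "\<delta> * (\<sigma> * sin t) \<le> 0" using sg[OF t(1)] d by (simp add: mult_le_0_iff)
      moreover have "(\<sigma> * \<sigma>) * x \<ge> 0" using x by simp
      ultimately have "(\<sigma> * \<sigma>) * x = 0" by linarith
      then have "x = 0" using \<sigma> by simp
      then show False using \<open>x * \<sigma> = \<delta> * sin t\<close> \<open>sin t \<noteq> 0\<close> d by simp
    qed
  qed
  have cK: "compact (K \<union> c ` {a..b})" for a b
    by (intro compact_Un K compact_continuous_image cont) simp
  \<comment> \<open>The pole leaves to the left, away from the right half circle; for the left half
    circle the directions are exchanged.\<close>
  have right: "entire_approx (K \<union> c ` {0..pi}) (\<lambda>z. 1 / (z - p))"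
    by (rule entire_approx_pole_ray[OF cK, of "of_real (-1)"]) (use off[of _ "-1" 0 pi] sin_ge_zero in auto)
  have left: "entire_approx (K \<union> c ` {pi..2*pi}) (\<lambda>z. 1 / (z - p))"
    by (rule entire_approx_pole_ray[OF cK, of "of_real 1"]) (use off[of _ 1 pi "2*pi"] sin_le_zero in force)+
  have "compact (m ` sphere p \<delta>)"
    by (intro compact_continuous_image holomorphic_on_imp_continuous_on holomorphic_on_subset[OF m(1)]) auto
  then obtain M where M: "M > 0" "\<And>z. z \<in> sphere p \<delta> \<Longrightarrow> norm (m z) \<le> M"
    by (metis bounded_pos compact_imp_bounded imageI)
  \<comment> \<open>The first bound makes two approximations differ by less than
    \<open>\<eta>\<close> on \<open>K\<close>; the second keeps the total error over both half
    circles below \<open>norm (m p)\<close>.\<close>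
  define e where "e = min (\<eta> / 2) (norm (m p) / (2 * pi * M * \<delta>))"
  have e: "e > 0" using \<eta> m d M by (simp add: e_def)
  have eM: "M * e * \<delta> * (2 * pi) \<le> norm (m p)"
  proof -
    have "e \<le> norm (m p) / (2 * pi * M * \<delta>)" by (simp add: e_def)
    then show ?thesis using M d by (simp add: field_simps)
  qed
  obtain g1 where g1: "g1 holomorphic_on UNIV"
    "\<And>z. z \<in> K \<union> c ` {0..pi} \<Longrightarrow> norm (g1 z - 1 / (z - p)) < e"
    using entire_approxD[OF right e] by blast
  obtain g2 where g2: "g2 holomorphic_on UNIV"
    "\<And>z. z \<in> K \<union> c ` {pi..2*pi} \<Longrightarrow> norm (g2 z - 1 / (z - p)) < e"
    using entire_approxD[OF left e] by blast
  \<comment> \<open>Cauchy's formula in a variable rotated by \<open>- \<i>\<close>, so that the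
    standard parametrisation of the circle becomes \<open>c\<close>.\<close>
  have "((\<lambda>z. m (p - \<i> * z) / (z - 0)) has_contour_integral 2 * of_real pi * \<i> * m (p - \<i> * 0)) (circlepath 0 \<delta>)"
    by (rule Cauchy_integral_circlepath_simple[where f = "\<lambda>z. m (p - \<i> * z)"])
       (auto intro!: holomorphic_on_compose_gen[OF _ m(1), unfolded o_def] holomorphic_intros simp: d)
  then have "((\<lambda>t. m (p - \<i> * (0 + of_real \<delta> * cis t)) / (0 + of_real \<delta> * cis t - 0) * of_real \<delta> * \<i> * cis t)
       has_integral 2 * of_real pi * \<i> * m p) {0..2*pi}"
    unfolding circlepath_def by (subst (asm) has_contour_integral_part_circlepath_iff) auto
  moreover have "m (p - \<i> * (0 + of_real \<delta> * cis t)) / (0 + of_real \<delta> * cis t - 0) * of_real \<delta> * \<i> * cis t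
      = \<i> * m (c t)" for t
    using d by (simp add: c_def mult.assoc)
  ultimately have int: "((\<lambda>t. \<i> * m (c t)) has_integral 2 * of_real pi * \<i> * m p) {0..2*pi}"
    by (simp only:)
  have split: "integral {0..pi} (\<lambda>t. \<i> * m (c t)) + integral {pi..2*pi} (\<lambda>t. \<i> * m (c t))
      = 2 * of_real pi * \<i> * m p"
    using Henstock_Kurzweil_Integration.integral_combine[of 0 pi "2 * pi" "\<lambda>t. \<i> * m (c t)"] int
    by (simp add: has_integral_iff)
  show ?thesis
  proof (rule that[of "\<lambda>z. g1 z - g2 z"])
    show "(\<lambda>z. g1 z - g2 z) holomorphic_on UNIV" by (intro holomorphic_intros g1 g2)
    show "norm (g1 z - g2 z) < \<eta>" if "z \<in> K" for z
    proof -
      have "norm (g1 z - 1 / (z - p)) < e" "norm (g2 z - 1 / (z - p)) < e"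
        using g1(2) g2(2) that by auto
      then have "norm ((g1 z - 1 / (z - p)) - (g2 z - 1 / (z - p))) < e + e"
        using norm_triangle_ineq4[of "g1 z - 1 / (z - p)" "g2 z - 1 / (z - p)"] by linarith
      moreover have "e + e \<le> \<eta>" by (simp add: e_def min_def)
      ultimately show ?thesis by simp
    qed
    fix \<Phi> assume \<Phi>: "\<And>z. (\<Phi> has_field_derivative m z * (g1 z - g2 z)) (at z)"
    have "(\<lambda>z. m z * g1 z) holomorphic_on UNIV" by (intro holomorphic_intros m g1)
    then obtain \<Phi>1 where \<Phi>1: "\<And>z. (\<Phi>1 has_field_derivative m z * g1 z) (at z)"
      using entire_primitive by blast
    define \<Phi>2 where "\<Phi>2 z = \<Phi>1 z - \<Phi> z" for z
    have \<Phi>2: "(\<Phi>2 has_field_derivative m z * g2 z) (at z)" for z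
      unfolding \<Phi>2_def[abs_def] by (auto intro!: derivative_eq_intros \<Phi>1 \<Phi> simp: algebra_simps)
    have ends: "c 0 = p - \<i> * of_real \<delta>" "c pi = p + \<i> * of_real \<delta>" "c (2 * pi) = p - \<i> * of_real \<delta>"
      by (simp_all add: c_def cis_2pi)
    have A1: "norm (\<Phi>1 (c pi) - \<Phi>1 (c 0) - integral {0..pi} (\<lambda>t. \<i> * m (c t))) \<le> M * e * \<delta> * (pi - 0)"
      by (rule arc_integral[OF _ _ d m(1) M(2) c_def _ \<Phi>1]) (use g1(2) e in \<open>auto intro: less_imp_le\<close>)
    have A2: "norm (\<Phi>2 (c (2*pi)) - \<Phi>2 (c pi) - integral {pi..2*pi} (\<lambda>t. \<i> * m (c t))) \<le> M * e * \<delta> * (2*pi - pi)"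
      by (rule arc_integral[OF _ _ d m(1) M(2) c_def _ \<Phi>2]) (use g2(2) e in \<open>auto intro: less_imp_le\<close>)
    define J where "J = \<Phi> (p + \<i> * of_real \<delta>) - \<Phi> (p - \<i> * of_real \<delta>)"
    \<comment> \<open>The second arc is run downwards, so the increments of \<open>\<Phi>1\<close>
      over the closed circle cancel and only that of \<open>\<Phi>\<close> remains.\<close>
    have "J - 2 * of_real pi * \<i> * m p
        = (\<Phi>1 (c pi) - \<Phi>1 (c 0) - integral {0..pi} (\<lambda>t. \<i> * m (c t)))
        + (\<Phi>2 (c (2*pi)) - \<Phi>2 (c pi) - integral {pi..2*pi} (\<lambda>t. \<i> * m (c t)))"
      unfolding split[symmetric] J_def ends \<Phi>2_def by (simp add: algebra_simps)
    then have "norm (J - 2 * of_real pi * \<i> * m p) \<le> M * e * \<delta> * (pi - 0) + M * e * \<delta> * (2*pi - pi)"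
      using A1 A2 norm_triangle_mono by metis
    then have le: "norm (J - 2 * of_real pi * \<i> * m p) \<le> norm (m p)"
      using eM by (simp add: algebra_simps)
    \<comment> \<open>The residue has size \<open>2 * pi * norm (m p)\<close> and the error is at
      most \<open>norm (m p)\<close>, so at least \<open>norm (m p)\<close> is left.\<close>
    have "2 * norm (m p) \<le> (2 * pi) * norm (m p)" using pi_gt3 by (intro mult_right_mono) auto
    also have "\<dots> = norm (2 * of_real pi * \<i> * m p)" by (simp add: norm_mult)
    also have "\<dots> \<le> norm J + norm (J - 2 * of_real pi * \<i> * m p)"
      by (metis norm_minus_commute norm_triangle_sub)
    finally show "norm (\<Phi> (p + \<i> * of_real \<delta>) - \<Phi> (p - \<i> * of_real \<delta>)) \<ge> norm (m p)"
      using le by (simp add: J_def)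
  qed
qed

section \<open>The rotation step\<close>

lemma compact_disc_off_strip: "compact {z. norm z \<le> 2 \<and> \<delta> \<le> \<bar>Im z - y\<bar>}"
proof -
  have "{z. norm z \<le> 2 \<and> \<delta> \<le> \<bar>Im z - y\<bar>} = cball 0 2 \<inter> {z. \<delta> \<le> \<bar>Im z - y\<bar>}" by auto
  also have "compact \<dots>"
    by (intro compact_Int_closed closed_Collect_le continuous_intros) auto
  finally show ?thesis .
qed

lemma entire_bounded_disc:
  assumes "f holomorphic_on UNIV"
  obtains B where "\<And>z. norm z \<le> R \<Longrightarrow> norm (f z) \<le> B"
proof -
  have "compact (f ` cball 0 R)"
    by (intro compact_continuous_image holomorphic_on_imp_continuous_on holomorphic_on_subset[OF assms]) auto
  then have "bounded (f ` cball 0 R)" by (rule compact_imp_bounded)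
  then obtain B where "\<forall>x\<in>f ` cball 0 R. norm x \<le> B" unfolding bounded_iff ..
  then show ?thesis by (intro that[of B]) auto
qed

text \<open>By the identity theorem \<open>v\<close> cannot vanish on a whole segment. The range up
  to \<open>1 / 2\<close> keeps points at heights between 0 and 1 over it inside the disc of radius
  2.\<close>

lemma nonzero_on_horizontal_segment:
  assumes v: "v holomorphic_on UNIV" "v a \<noteq> 0"
  obtains x where "0 \<le> x" "x \<le> 1 / 2" "v (Complex x y) \<noteq> 0"
proof (rule ccontr)
  note nonzero = that
  assume "\<not> thesis"
  then have zero: "v (Complex x y) = 0" if "0 \<le> x" "x \<le> 1 / 2" for x
    using \<open>\<not> thesis\<close> that nonzero by blast
  define S where "S = (\<lambda>x. Complex x y) ` {0..1/2}"
  have "Complex 0 y islimpt S"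
    unfolding islimpt_approachable
  proof (intro allI impI)
    fix e :: real assume e: "e > 0"
    show "\<exists>x'\<in>S. x' \<noteq> Complex 0 y \<and> dist x' (Complex 0 y) < e"
    proof (rule bexI[of _ "Complex (min (1/2) (e/2)) y"])
      have "dist (Complex (min (1/2) (e/2)) y) (Complex 0 y) = \<bar>min (1/2) (e/2)\<bar>"
        by (simp add: dist_norm norm_complex_def)
      also have "\<dots> < e" using e by (auto simp: min_def)
      finally show "Complex (min (1/2) (e/2)) y \<noteq> Complex 0 y \<and> dist (Complex (min (1/2) (e/2)) y) (Complex 0 y) < e"
        using e by (auto simp: min_def)
    qed (use e in \<open>auto simp: S_def min_def\<close>)
  qed
  moreover have "v z = 0" if "z \<in> S" for z using that zero by (auto simp: S_def)
  ultimately have "v a = 0"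
    using analytic_continuation[OF v(1) open_UNIV connected_UNIV, of S] by simp
  with v show False by simp
qed

lemma small_angle:
  assumes "e > 0"
  obtains h where "h > 0" "\<And>w::complex. norm w \<le> h \<Longrightarrow> norm (cos w - 1) \<le> e \<and> norm (sin w) \<le> e"
proof -
  have "isCont (\<lambda>w::complex. cos w) 0" "isCont (\<lambda>w::complex. sin w) 0" by (auto intro!: continuous_intros)
  then obtain h1 h2 where h: "h1 > 0" "\<And>w::complex. dist w 0 < h1 \<Longrightarrow> dist (cos w) (cos 0) < e"
     "h2 > 0" "\<And>w::complex. dist w 0 < h2 \<Longrightarrow> dist (sin w) (sin 0) < e"
    using assms unfolding continuous_at_eps_delta by metis
  show ?thesis
    by (rule that[of "min h1 h2 / 2"]) (use h in \<open>auto simp: dist_norm intro!: less_imp_le\<close>)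
qed

text \<open>Rotating the pair \<open>(u, v)\<close> by the complex angle \<open>\<zeta> g\<close>, with \<open>g\<close> tiny off a horizontal strip
  but with a nontrivial integral against \<open>v\<close> across it. The displacement \<open>I \<zeta>\<close> of the primitive of
  the first component is entire in \<open>\<zeta>\<close> with derivative of size at least \<open>norm (v p)\<close> at \<open>0\<close>, so
  \<open>Re (I \<zeta>)\<close> is large for some \<open>\<zeta>\<close> of controlled size.\<close>

lemma rotation_step:
  assumes u: "u holomorphic_on UNIV" and v: "v holomorphic_on UNIV" "v a \<noteq> 0"
    and st: "0 < s" "s < t" "t \<le> 1" and \<epsilon>: "\<epsilon> > 0"
  obtains \<theta> P Q where
    "\<And>z. (P has_field_derivative u z * (cos (\<theta> z) - 1) - v z * sin (\<theta> z)) (at z)"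
    "\<And>z. (Q has_field_derivative u z * sin (\<theta> z) + v z * (cos (\<theta> z) - 1)) (at z)"
    "\<And>z. norm z \<le> 2 \<Longrightarrow> t \<le> Im z \<Longrightarrow> norm (cos (\<theta> z) - 1) \<le> \<epsilon> \<and> norm (sin (\<theta> z)) \<le> \<epsilon>"
    "\<And>z. norm z \<le> 2 \<Longrightarrow> t \<le> Im z \<Longrightarrow> norm (P z) \<le> \<epsilon> \<and> norm (Q z) \<le> \<epsilon>"
    "\<And>z. norm z \<le> 2 \<Longrightarrow> Im z \<le> s \<Longrightarrow> Re (P z) \<ge> T"
proof -
  \<comment> \<open>Middle and half-width of the strip, so that \<open>\<alpha>\<close> and
    \<open>\<beta>\<close> lie exactly on its upper and lower edges.\<close>
  define y where "y = (s + t) / 2"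
  define \<delta> where "\<delta> = (t - s) / 2"
  have \<delta>: "\<delta> > 0" using st by (simp add: \<delta>_def)
  obtain x where x: "0 \<le> x" "x \<le> 1 / 2" "v (Complex x y) \<noteq> 0"
    using nonzero_on_horizontal_segment[OF v] .
  define p where "p = Complex x y"
  define \<alpha> where "\<alpha> = p + \<i> * of_real \<delta>"
  define \<beta> where "\<beta> = p - \<i> * of_real \<delta>"
  have \<alpha>\<beta>: "Re \<alpha> = x" "Im \<alpha> = t" "Re \<beta> = x" "Im \<beta> = s"
    by (simp_all add: \<alpha>_def \<beta>_def p_def y_def \<delta>_def field_simps)
  have n\<alpha>: "norm \<alpha> \<le> 2" and n\<beta>: "norm \<beta> \<le> 2"
    using cmod_le[of \<alpha>] cmod_le[of \<beta>] x st by (simp_all add: \<alpha>\<beta>)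
  obtain B1 where B1: "\<And>z. norm z \<le> 2 \<Longrightarrow> norm (u z) \<le> B1" using entire_bounded_disc[OF u] by blast
  obtain B2 where B2: "\<And>z. norm z \<le> 2 \<Longrightarrow> norm (v z) \<le> B2" using entire_bounded_disc[OF v(1)] by blast
  define M where "M = max 1 (max B1 B2)"
  have M: "M \<ge> 1" "\<And>z. norm z \<le> 2 \<Longrightarrow> norm (u z) \<le> M" "\<And>z. norm z \<le> 2 \<Longrightarrow> norm (v z) \<le> M"
    using B1 B2 by (auto simp: M_def le_max_iff_disj)
  \<comment> \<open>Off the strip the derivatives of \<open>P\<close> and \<open>Q\<close> are at
    most \<open>2 * M * e\<close>, and points of the disc are at most 4 apart: hence the factor
    8.\<close>
  define e where "e = min \<epsilon> 1 / (8 * M)"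
  have e: "e > 0" "e \<le> \<epsilon>" "8 * M * e \<le> \<epsilon>" "8 * M * e \<le> 1"
  proof -
    show "e > 0" "8 * M * e \<le> \<epsilon>" "8 * M * e \<le> 1" using M \<epsilon> by (auto simp: e_def)
    have "1 * e \<le> 8 * M * e" using M \<open>e > 0\<close> by (intro mult_right_mono) auto
    then show "e \<le> \<epsilon>" using \<open>8 * M * e \<le> \<epsilon>\<close> by simp
  qed
  obtain h where h: "h > 0" "\<And>w::complex. norm w \<le> h \<Longrightarrow> norm (cos w - 1) \<le> e \<and> norm (sin w) \<le> e"
    using small_angle[OF e(1)] by blast
  have vp: "v p \<noteq> 0" using x by (simp add: p_def)
  \<comment> \<open>Only \<open>T\<close> and \<open>v p\<close> enter, so \<open>g\<close> can
    afterwards be made small relative to \<open>\<rho>\<close>. The 3 absorbs an error of at most 1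
    at \<open>\<alpha>\<close> and one of at most 1 below the strip; the factor 2 makes the next
    inequality strict.\<close>
  define \<rho> where "\<rho> = 2 * exp (T + 3) / norm (v p)"
  have \<rho>: "\<rho> > 0" "exp (T + 3) < \<rho> * norm (v p)" using vp by (simp_all add: \<rho>_def)
  define K where "K = {z. norm z \<le> 2 \<and> \<delta> \<le> \<bar>Im z - y\<bar>}"
  obtain g where g: "g holomorphic_on UNIV" "\<And>z. z \<in> K \<Longrightarrow> norm (g z) < h / \<rho>"
    "\<And>\<Phi>. (\<And>z. (\<Phi> has_field_derivative v z * g z) (at z)) \<Longrightarrow> norm (\<Phi> \<alpha> - \<Phi> \<beta>) \<ge> norm (v p)"
  proof (rule entire_small_off_strip[OF v(1) vp, of K \<delta> "h / \<rho>"])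
    show "compact K" unfolding K_def by (rule compact_disc_off_strip)
  qed (use \<delta> h \<rho> in \<open>auto simp: K_def p_def \<alpha>_def \<beta>_def\<close>)
  \<comment> \<open>The path crosses the strip downwards, so integrals along it are increments from
    \<open>\<alpha>\<close> to \<open>\<beta>\<close>.\<close>
  define \<gamma> where "\<gamma> r = \<alpha> + of_real r * (\<beta> - \<alpha>)" for r :: real
  have \<gamma>d: "(\<gamma> has_vector_derivative (\<beta> - \<alpha>)) (at r within S)" for r S
    unfolding \<gamma>_def[abs_def]
    by (rule has_vector_derivative_real_field) (auto intro!: derivative_eq_intros)
  have along: "((\<lambda>r. f (\<gamma> r) * (\<beta> - \<alpha>)) has_integral (F \<beta> - F \<alpha>)) {0..1}"
    if F: "\<And>z. (F has_field_derivative f z) (at z)" for f F :: "complex \<Rightarrow> complex"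
  proof -
    have "((\<lambda>r. F (\<gamma> r)) has_vector_derivative f (\<gamma> r) * (\<beta> - \<alpha>)) (at r within {0..1})" for r
      using field_vector_diff_chain_within[OF \<gamma>d has_field_derivative_at_within[OF F]]
      by (simp add: o_def mult.commute)
    then show ?thesis
      using fundamental_theorem_of_calculus[of 0 1 "\<lambda>r. F (\<gamma> r)" "\<lambda>r. f (\<gamma> r) * (\<beta> - \<alpha>)"]
      by (simp add: \<gamma>_def)
  qed
  have cont: "continuous_on {0..1} (\<lambda>r. f (\<gamma> r))" if "f holomorphic_on UNIV" for f
    by (rule continuous_on_compose2[OF holomorphic_on_imp_continuous_on[OF that]])
       (auto simp: \<gamma>_def intro!: continuous_intros)
  obtain \<Phi> where \<Phi>: "\<And>z. (\<Phi> has_field_derivative v z * g z) (at z)"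
    using entire_primitive[of "\<lambda>z. v z * g z"] by (metis g(1) holomorphic_on_mult v(1))
  define c where "c = integral {0..1} (\<lambda>r. (v (\<gamma> r) * (\<beta> - \<alpha>)) * g (\<gamma> r))"
  have "c = \<Phi> \<beta> - \<Phi> \<alpha>"
    using integral_unique[OF along[OF \<Phi>]] by (simp add: c_def ac_simps)
  then have nc: "norm c \<ge> norm (v p)" using g(3)[OF \<Phi>] by (simp add: norm_minus_commute)
  have "\<exists>\<zeta>. norm \<zeta> \<le> \<rho> \<and> Re (integral {0..1} (\<lambda>r. (u (\<gamma> r) * (\<beta> - \<alpha>)) * (cos (\<zeta> * g (\<gamma> r)) - 1)
       - (v (\<gamma> r) * (\<beta> - \<alpha>)) * sin (\<zeta> * g (\<gamma> r)))) > T + 3"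
  proof (rule cosine_gain[OF _ _ _ c_def \<rho>(1)])
    show "exp (T + 3) < \<rho> * norm c"
      using \<rho> nc by (meson less_le_trans mult_left_mono less_imp_le)
  qed (auto intro!: continuous_intros cont u v g holomorphic_intros)
  then obtain \<zeta> where \<zeta>: "norm \<zeta> \<le> \<rho>"
    "Re (integral {0..1} (\<lambda>r. (u (\<gamma> r) * (\<beta> - \<alpha>)) * (cos (\<zeta> * g (\<gamma> r)) - 1)
       - (v (\<gamma> r) * (\<beta> - \<alpha>)) * sin (\<zeta> * g (\<gamma> r)))) > T + 3"
    by blast
  define \<theta> where "\<theta> z = \<zeta> * g z" for z
  have \<theta>h: "\<theta> holomorphic_on UNIV" unfolding \<theta>_def[abs_def] by (intro holomorphic_intros g)
  define dP where "dP z = u z * (cos (\<theta> z) - 1) - v z * sin (\<theta> z)" for z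
  define dQ where "dQ z = u z * sin (\<theta> z) + v z * (cos (\<theta> z) - 1)" for z
  have "dP holomorphic_on UNIV" unfolding dP_def[abs_def] by (intro holomorphic_intros u v \<theta>h)
  \<comment> \<open>The base point \<open>\<i>\<close> lies above the strip or on its edge, so a
    small derivative there makes \<open>P\<close> itself small; likewise for
    \<open>Q\<close>.\<close>
  then obtain P where P: "\<And>z. (P has_field_derivative dP z) (at z)" "P \<i> = 0"
    using entire_primitive by blast
  have "dQ holomorphic_on UNIV" unfolding dQ_def[abs_def] by (intro holomorphic_intros u v \<theta>h)
  then obtain Q where Q: "\<And>z. (Q has_field_derivative dQ z) (at z)" "Q \<i> = 0"
    using entire_primitive by blast
  have \<theta>small: "norm (cos (\<theta> z) - 1) \<le> e \<and> norm (sin (\<theta> z)) \<le> e" if "z \<in> K" for z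
  proof -
    have "norm (\<theta> z) \<le> \<rho> * (h / \<rho>)"
      unfolding \<theta>_def norm_mult using \<zeta>(1) g(2)[OF that] \<rho> by (intro mult_mono) auto
    then show ?thesis using h(2) \<rho> by simp
  qed
  have small: "norm (dP z) \<le> 2 * M * e \<and> norm (dQ z) \<le> 2 * M * e" if z: "z \<in> K" for z
  proof -
    have nz: "norm z \<le> 2" using z by (simp add: K_def)
    have *: "norm (u z * w1) \<le> M * e" "norm (v z * w1) \<le> M * e" if "norm w1 \<le> e" for w1
      unfolding norm_mult using that M(1) M(2,3)[OF nz] by (auto intro!: mult_mono)
    have "norm (dP z) \<le> norm (u z * (cos (\<theta> z) - 1)) + norm (v z * sin (\<theta> z))"
      unfolding dP_def by (rule norm_triangle_ineq4)
    moreover have "norm (dQ z) \<le> norm (u z * sin (\<theta> z)) + norm (v z * (cos (\<theta> z) - 1))"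
      unfolding dQ_def by (rule norm_triangle_ineq)
    moreover have "norm (cos (\<theta> z) - 1) \<le> e" "norm (sin (\<theta> z)) \<le> e" using \<theta>small[OF z] by auto
    note *(1)[OF this(1)] *(2)[OF this(1)] *(1)[OF this(2)] *(2)[OF this(2)]
    ultimately show ?thesis by linarith
  qed
  \<comment> \<open>\<open>K\<close> is the union of two convex pieces. The mean value estimate
    applies to each separately and gives nothing across the strip.\<close>
  define A where "A = cball (0::complex) 2 \<inter> {z. t \<le> Im z}"
  define C where "C = cball (0::complex) 2 \<inter> {z. Im z \<le> s}"
  have conv: "convex A" "convex C" unfolding A_def C_def
    by (auto intro!: convex_Int convex_halfspace_Im_ge convex_halfspace_Im_le)
  have AC: "A \<subseteq> K" "C \<subseteq> K" using st by (auto simp: A_def C_def K_def y_def \<delta>_def abs_if field_simps)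
  have osc: "norm (F z - F w) \<le> 8 * M * e"
    if F: "\<And>z. (F has_field_derivative f z) (at z)" and S: "convex S" "S \<subseteq> K"
      and f: "\<And>z. z \<in> K \<Longrightarrow> norm (f z) \<le> 2 * M * e" and zw: "z \<in> S" "w \<in> S" for F f S z w
  proof -
    have "norm (F z - F w) \<le> (2 * M * e) * norm (z - w)"
      by (rule field_differentiable_bound[OF S(1) has_field_derivative_at_within[OF F] _ zw]) (use S f in auto)
    also have "norm (z - w) \<le> 4"
    proof -
      have "z \<in> K" "w \<in> K" using zw S(2) by auto
      then show ?thesis using norm_triangle_ineq4[of z w] by (simp add: K_def)
    qed
    finally show ?thesis using M e by simp
  qed
  have iA: "\<i> \<in> A" and \<alpha>A: "\<alpha> \<in> A" and \<beta>C: "\<beta> \<in> C"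
    using st n\<alpha> n\<beta> by (auto simp: A_def C_def \<alpha>\<beta>)
  have "P \<beta> - P \<alpha> = integral {0..1} (\<lambda>r. (u (\<gamma> r) * (\<beta> - \<alpha>)) * (cos (\<zeta> * g (\<gamma> r)) - 1)
       - (v (\<gamma> r) * (\<beta> - \<alpha>)) * sin (\<zeta> * g (\<gamma> r)))"
    using integral_unique[OF along[OF P(1)]] by (simp add: dP_def \<theta>_def algebra_simps)
  then have gain: "Re (P \<beta>) - Re (P \<alpha>) > T + 3" using \<zeta>(2) by (metis minus_complex.simps(1))
  have smallP: "norm (P z) \<le> 8 * M * e" and smallQ: "norm (Q z) \<le> 8 * M * e" if "z \<in> A" for z
    using osc[OF P(1) conv(1) AC(1) _ that iA] osc[OF Q(1) conv(1) AC(1) _ that iA] small P(2) Q(2) by auto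
  show ?thesis
  proof (rule that[OF P(1)[unfolded dP_def] Q(1)[unfolded dQ_def]])
    fix z :: complex assume z: "norm z \<le> 2" "t \<le> Im z"
    then have zA: "z \<in> A" by (simp add: A_def)
    show "norm (cos (\<theta> z) - 1) \<le> \<epsilon> \<and> norm (sin (\<theta> z)) \<le> \<epsilon>"
      using \<theta>small AC(1) zA e(2) by force
    show "norm (P z) \<le> \<epsilon> \<and> norm (Q z) \<le> \<epsilon>"
      using smallP[OF zA] smallQ[OF zA] e(3) by simp
  next
    fix z :: complex assume z: "norm z \<le> 2" "Im z \<le> s"
    then have zC: "z \<in> C" by (simp add: C_def)
    have "norm (P z - P \<beta>) \<le> 1" using osc[OF P(1) conv(2) AC(2) _ zC \<beta>C] small e(4) by force
    then have "\<bar>Re (P z) - Re (P \<beta>)\<bar> \<le> 1" by (metis abs_Re_le_cmod minus_complex.simps(1) order_trans)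
    moreover have "\<bar>Re (P \<alpha>)\<bar> \<le> 1" using smallP[OF \<alpha>A] e(4) abs_Re_le_cmod[of "P \<alpha>"] by simp
    ultimately show "Re (P z) \<ge> T" using gain by linarith
  qed
qed

section \<open>Real parts of null curves\<close>

definition re_part :: "(3 \<Rightarrow> complex \<Rightarrow> complex) \<Rightarrow> complex \<Rightarrow> real^3" where
  "re_part F z = (\<chi> j. Re (F j z))"

lemma re_part_nth [simp]: "re_part F z $ j = Re (F j z)"
  by (simp add: re_part_def)

lemma has_derivative_re_part:
  assumes "\<And>j. (F j has_field_derivative f j) (at z)"
  shows "(re_part F has_derivative (\<lambda>h. \<chi> j. Re (f j * h))) (at z)"
proof -
  have "((\<lambda>w. \<Sum>j\<in>UNIV. Re (F j w) *\<^sub>R axis j (1::real)) has_derivative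
      (\<lambda>h. \<Sum>j\<in>UNIV. Re (f j * h) *\<^sub>R axis j (1::real))) (at z)"
    using assms[unfolded has_field_derivative_def]
    by (intro has_derivative_sum has_derivative_scaleR_left has_derivative_Re) auto
  moreover have "(\<Sum>j\<in>UNIV. c j *\<^sub>R axis j (1::real)) = (\<chi> j. c j)" for c :: "3 \<Rightarrow> real"
    by (simp add: vec_eq_iff axis_def if_distrib cong: if_cong)
  ultimately show ?thesis by (simp add: re_part_def[abs_def])
qed

lemma frechet_derivative_re_part:
  assumes "\<And>j. F j holomorphic_on U" "open U" "z \<in> U"
  shows "frechet_derivative (re_part F) (at z) = (\<lambda>h. \<chi> j. Re (deriv (F j) z * h))"
    and "re_part F differentiable (at z)"
proof -
  have "(re_part F has_derivative (\<lambda>h. \<chi> j. Re (deriv (F j) z * h))) (at z)"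
    by (rule has_derivative_re_part) (use assms in \<open>auto intro: holomorphic_derivI\<close>)
  then show "frechet_derivative (re_part F) (at z) = (\<lambda>h. \<chi> j. Re (deriv (F j) z * h))"
    and "re_part F differentiable (at z)"
    using frechet_derivative_at[symmetric] differentiable_def by blast+
qed

lemma du_re_part:
  assumes "\<And>j. F j holomorphic_on U" "open U" "z \<in> U"
  shows "du (re_part F) z = re_part (\<lambda>j. deriv (F j)) z"
  by (simp add: du_def frechet_derivative_re_part[OF assms] vec_eq_iff)

lemma dv_re_part:
  assumes "\<And>j. F j holomorphic_on U" "open U" "z \<in> U"
  shows "dv (re_part F) z = re_part (\<lambda>j w. deriv (F j) w * \<i>) z"
  by (simp add: dv_def frechet_derivative_re_part[OF assms] vec_eq_iff)

text \<open>The formulas for \<open>du\<close> and \<open>dv\<close> of a real part hold only on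
  \<open>U\<close>; this allows them to be differentiated again there.\<close>

lemma frechet_derivative_cong_open:
  assumes "open U" "z \<in> U" "\<And>w. w \<in> U \<Longrightarrow> f w = g w"
  shows "frechet_derivative f (at z) = frechet_derivative g (at z)"
    and "f differentiable (at z) \<longleftrightarrow> g differentiable (at z)"
proof -
  have "(f has_derivative D) (at z) \<longleftrightarrow> (g has_derivative D) (at z)" for D
    using assms has_derivative_transform_within_open[of f D z UNIV U g]
      has_derivative_transform_within_open[of g D z UNIV U f] by auto
  then show "frechet_derivative f (at z) = frechet_derivative g (at z)"
    and "f differentiable (at z) \<longleftrightarrow> g differentiable (at z)"
    by (simp_all add: frechet_derivative_def differentiable_def)
qed

lemma Ck_on_cong:
  assumes "open U" "\<And>w. w \<in> U \<Longrightarrow> f w = g w" "Ck_on k U f"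
  shows "Ck_on k U g"
  using assms(2,3)
proof (induction k arbitrary: f g)
  case 0
  then show ?case by (simp cong: continuous_on_cong)
next
  case (Suc k)
  have e: "du f w = du g w" "dv f w = dv g w" if "w \<in> U" for w
    using frechet_derivative_cong_open(1)[OF assms(1) that Suc.prems(1)] by (simp_all add: du_def dv_def)
  have "g differentiable (at z)" if "z \<in> U" for z
    using frechet_derivative_cong_open(2)[OF assms(1) that, of f g] Suc.prems that by simp
  then show ?case
    using Suc.IH[of "du f" "du g"] Suc.IH[of "dv f" "dv g"] e Suc.prems(2) by simp
qed

text \<open>Both partial derivatives of a real part are again real parts of holomorphic maps, so the
  induction runs over all \<open>F\<close> at once.\<close>

lemma Ck_on_re_part:
  assumes "open U" "\<And>j. F j holomorphic_on U"
  shows "Ck_on k U (re_part F)"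
  using assms(2)
proof (induction k arbitrary: F)
  case 0
  have "continuous_on U (\<lambda>z. \<chi> j. Re (F j z))"
    by (intro continuous_on_vec_lambda continuous_on_Re holomorphic_on_imp_continuous_on 0)
  then show ?case by (simp add: re_part_def[abs_def])
next
  case (Suc k)
  have "Ck_on k U (re_part (\<lambda>j. deriv (F j)))"
    by (intro Suc.IH holomorphic_deriv Suc.prems assms(1))
  moreover have "Ck_on k U (re_part (\<lambda>j w. deriv (F j) w * \<i>))"
    by (intro Suc.IH holomorphic_intros holomorphic_deriv Suc.prems assms(1))
  ultimately show ?case
    using frechet_derivative_re_part(2)[OF Suc.prems assms(1)]
      Ck_on_cong[OF assms(1) du_re_part[OF Suc.prems assms(1), symmetric]]
      Ck_on_cong[OF assms(1) dv_re_part[OF Suc.prems assms(1), symmetric]]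
    by simp
qed

text \<open>Since \<open>Re x * Re y = Re (x * y + x * cnj y) / 2\<close>, the inner product splits
  into a multiple of the null quadric, which vanishes, and a Hermitian part.\<close>

lemma inner_re_null:
  fixes a :: "3 \<Rightarrow> complex"
  assumes "a 1 ^ 2 + a 2 ^ 2 + a 3 ^ 2 = 0"
  shows "(\<chi> j. Re (a j * v)) \<bullet> (\<chi> j. Re (a j * w))
    = ((norm (a 1))\<^sup>2 + (norm (a 2))\<^sup>2 + (norm (a 3))\<^sup>2) / 2 * (v \<bullet> w)"
proof -
  have *: "Re x * Re y = Re (x * y + x * cnj y) / 2" for x y by simp
  have "(\<chi> j. Re (a j * v)) \<bullet> (\<chi> j. Re (a j * w))
      = Re (a 1 * v) * Re (a 1 * w) + Re (a 2 * v) * Re (a 2 * w) + Re (a 3 * v) * Re (a 3 * w)"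
    by (simp add: inner_vec_def sum_3)
  also have "\<dots> = Re ((a 1 ^ 2 + a 2 ^ 2 + a 3 ^ 2) * (v * w)
      + (a 1 * cnj (a 1) + a 2 * cnj (a 2) + a 3 * cnj (a 3)) * (v * cnj w)) / 2"
    unfolding * by (simp add: algebra_simps power2_eq_square add_divide_distrib diff_divide_distrib)
  also have "\<dots> = Re (of_real ((norm (a 1))\<^sup>2 + (norm (a 2))\<^sup>2 + (norm (a 3))\<^sup>2) * (v * cnj w)) / 2"
    unfolding assms complex_norm_square[symmetric] by simp
  also have "\<dots> = ((norm (a 1))\<^sup>2 + (norm (a 2))\<^sup>2 + (norm (a 3))\<^sup>2) / 2 * (v \<bullet> w)"
    by (simp add: inner_complex_def)
  finally show ?thesis .
qed

text \<open>The null condition makes the differential conformal, nonvanishing makes its factor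
  positive, and harmonicity kills the mean curvature.\<close>

lemma conformal_minimal_immersion_on_re_part:
  assumes U: "open U" "S \<subseteq> U" and F: "\<And>j. F j holomorphic_on U"
    and null: "\<And>z. z \<in> S \<Longrightarrow> (deriv (F 1) z)\<^sup>2 + (deriv (F 2) z)\<^sup>2 + (deriv (F 3) z)\<^sup>2 = 0"
    and nz: "\<And>z. z \<in> S \<Longrightarrow> \<exists>j. deriv (F j) z \<noteq> 0"
  shows "conformal_minimal_immersion_on S (re_part F)"
  unfolding conformal_minimal_immersion_on_def
proof (intro exI[of _ U] exI[of _ "re_part F"] conjI ballI)
  show "smooth_on U (re_part F)" using Ck_on_re_part[OF U(1) F] by (simp add: smooth_on_def)
  fix z assume z: "z \<in> S"
  then have zU: "z \<in> U" using U by auto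
  define c where "c = ((norm (deriv (F 1) z))\<^sup>2 + (norm (deriv (F 2) z))\<^sup>2 + (norm (deriv (F 3) z))\<^sup>2) / 2"
  have c: "c > 0"
  proof -
    obtain j where "deriv (F j) z \<noteq> 0" using nz[OF z] by auto
    then have "(norm (deriv (F 1) z))\<^sup>2 > 0 \<or> (norm (deriv (F 2) z))\<^sup>2 > 0 \<or> (norm (deriv (F 3) z))\<^sup>2 > 0"
      using exhaust_3[of j] by auto
    then show ?thesis
      using zero_le_power2[of "norm (deriv (F 1) z)"] zero_le_power2[of "norm (deriv (F 2) z)"]
        zero_le_power2[of "norm (deriv (F 3) z)"] unfolding c_def by argo
  qed
  have fd: "frechet_derivative (re_part F) (at z) = (\<lambda>h. \<chi> j. Re (deriv (F j) z * h))"
    by (rule frechet_derivative_re_part(1)[OF F U(1) zU])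
  have inner: "frechet_derivative (re_part F) (at z) v \<bullet> frechet_derivative (re_part F) (at z) w
      = c * (v \<bullet> w)" for v w
    unfolding fd c_def by (rule inner_re_null[of "\<lambda>j. deriv (F j) z", OF null[OF z]])
  then show "conformal_at (re_part F) z" unfolding conformal_at_def using c by blast
  have lin: "linear (frechet_derivative (re_part F) (at z))"
    by (rule linear_frechet_derivative[OF frechet_derivative_re_part(2)[OF F U(1) zU]])
  show "immersion_at (re_part F) z"
    unfolding immersion_at_def linear_injective_0[OF lin]
  proof (intro allI impI)
    fix v assume "frechet_derivative (re_part F) (at z) v = 0"
    then have "c * (v \<bullet> v) = 0" using inner[of v v] by simp
    then show "v = 0" using c by simp
  qed
  have du: "du (re_part F) w = re_part (\<lambda>j. deriv (F j)) w"
    and dv: "dv (re_part F) w = re_part (\<lambda>j w. deriv (F j) w * \<i>) w" if "w \<in> U" for w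
    using du_re_part[OF F U(1) that] dv_re_part[OF F U(1) that] by auto
  have "du (du (re_part F)) z = du (re_part (\<lambda>j. deriv (F j))) z"
    unfolding du_def[of "du (re_part F)"] du_def[of "re_part (\<lambda>j. deriv (F j))"]
    by (subst frechet_derivative_cong_open(1)[OF U(1) zU du]) auto
  also have "\<dots> = re_part (\<lambda>j. deriv (deriv (F j))) z"
    by (rule du_re_part[OF holomorphic_deriv[OF F U(1)] U(1) zU])
  finally have 1: "du (du (re_part F)) z = re_part (\<lambda>j. deriv (deriv (F j))) z" .
  have "dv (dv (re_part F)) z = dv (re_part (\<lambda>j w. deriv (F j) w * \<i>)) z"
    unfolding dv_def[of "dv (re_part F)"] dv_def[of "re_part (\<lambda>j w. deriv (F j) w * \<i>)"]
    by (subst frechet_derivative_cong_open(1)[OF U(1) zU dv]) auto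
  also have "\<dots> = re_part (\<lambda>j w. deriv (\<lambda>w. deriv (F j) w * \<i>) w * \<i>) z"
    by (rule dv_re_part[OF _ U(1) zU]) (intro holomorphic_intros holomorphic_deriv[OF F U(1)])
  finally have 2: "dv (dv (re_part F)) z = re_part (\<lambda>j w. deriv (\<lambda>w. deriv (F j) w * \<i>) w * \<i>) z" .
  have 3: "deriv (\<lambda>w. deriv (F j) w * \<i>) z = deriv (deriv (F j)) z * \<i>" for j
    by (rule DERIV_imp_deriv)
       (auto intro!: derivative_eq_intros holomorphic_derivI[OF holomorphic_deriv[OF F U(1)] U(1) zU])
  \<comment> \<open>The factor \<open>\<i>\<close> enters twice, so the Laplacian vanishes.\<close>
  have harm: "dv (dv (re_part F)) z = - du (du (re_part F)) z"
    unfolding 1 2 by (simp add: vec_eq_iff 3)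
  have E: "du (re_part F) z \<bullet> du (re_part F) z = c" "dv (re_part F) z \<bullet> dv (re_part F) z = c"
     "du (re_part F) z \<bullet> dv (re_part F) z = 0"
    unfolding du_def dv_def inner by (simp_all add: inner_complex_def)
  \<comment> \<open>In a conformal parametrisation the numerator is \<open>c\<close> times the
    normal component of the Laplacian.\<close>
  show "mean_curvature (re_part F) z = 0"
    unfolding mean_curvature_def Let_def E harm by simp
qed (use U in auto)

section \<open>The iteration\<close>

text \<open>Serves both as the angle of the line in stage \<open>k\<close> and as the height of the
  upper edge of the strip \<open>k\<close>.\<close>

definition level :: "nat \<Rightarrow> real" where
  "level k = 1 / real (Suc k)"

text \<open>\<open>height k F\<close> is the coordinate of \<open>re_part F\<close> along the normal of the line of slope
  \<open>tan (level k)\<close> in the plane of the first and third coordinates.\<close>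

definition height :: "nat \<Rightarrow> (3 \<Rightarrow> complex \<Rightarrow> complex) \<Rightarrow> complex \<Rightarrow> real" where
  "height k F z = cos (level k) * Re (F 3 z) - sin (level k) * Re (F 1 z)"

text \<open>A sum of moduli is enough to detect a nonzero derivative, and it can be compared
  componentwise by the triangle inequality.\<close>

definition speed :: "(3 \<Rightarrow> complex \<Rightarrow> complex) \<Rightarrow> complex \<Rightarrow> real" where
  "speed F z = norm (deriv (F 1) z) + norm (deriv (F 2) z) + norm (deriv (F 3) z)"

text \<open>The condition at \<open>\<i>\<close> keeps \<open>deriv (F 2)\<close> from vanishing
  identically, as the next rotation requires.\<close>

definition stage :: "nat \<Rightarrow> (3 \<Rightarrow> complex \<Rightarrow> complex) \<Rightarrow> bool" where
  "stage k F \<longleftrightarrow> (\<forall>j. F j holomorphic_on UNIV) \<and>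
     (\<forall>z. (deriv (F 1) z)\<^sup>2 + (deriv (F 2) z)\<^sup>2 + (deriv (F 3) z)\<^sup>2 = 0) \<and>
     (\<forall>z. speed F z > 0) \<and> deriv (F 2) \<i> \<noteq> 0 \<and>
     (\<forall>z. norm z \<le> 2 \<and> Im z \<le> level k \<longrightarrow> real k \<le> height k F z)"

text \<open>The equality of heights is exact and holds also inside the strip, where no other control
  exists. The speed factors have an infinite product of at least \<open>1 / 2\<close>.\<close>

definition refines :: "nat \<Rightarrow> (3 \<Rightarrow> complex \<Rightarrow> complex) \<Rightarrow> (3 \<Rightarrow> complex \<Rightarrow> complex) \<Rightarrow> bool" where
  "refines k F G \<longleftrightarrow> (\<forall>z. height k G z = height k F z) \<and>
     (\<forall>z. norm z \<le> 2 \<and> level k \<le> Im z \<longrightarrow>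
        (\<forall>j. norm (G j z - F j z) \<le> (1/2)^k) \<and> (1 - (1/2)^(k+2)) * speed F z \<le> speed G z)"

lemma level: "level k > 0" "level k \<le> 1" "level (Suc k) < level k"
  by (auto simp: level_def field_simps)

lemma level_antimono: "m \<le> n \<Longrightarrow> level n \<le> level m"
  by (auto simp: level_def field_simps)

lemma exists_level_le: "y > 0 \<Longrightarrow> \<exists>m. level m \<le> y"
  using reals_Archimedean[of y] by (auto simp: level_def inverse_eq_divide intro: less_imp_le)

lemma cos_level_pos: "cos (level k) > 0"
proof (rule cos_gt_zero)
  show "level k < pi / 2" using level(2)[of k] pi_gt3 by linarith
qed (rule level)

lemma sin_level_nonneg: "sin (level k) \<ge> 0"
  by (rule sin_ge_zero) (use level(1,2)[of k] pi_gt3 in linarith)+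

lemma stage_0: "\<exists>F. stage 0 F"
proof -
  \<comment> \<open>A flat disc with null derivative \<open>(1, \<i>, 0)\<close>. The constant third
    component makes the height \<open>2 - sin 1 * Re z\<close>, which is nonnegative on the disc of
    radius 2.\<close>
  define F :: "3 \<Rightarrow> complex \<Rightarrow> complex" where
    "F j = (if j = 1 then (\<lambda>z. z) else if j = 2 then (\<lambda>z. \<i> * z) else (\<lambda>z. of_real (2 / cos 1)))" for j
  have F: "F 1 = (\<lambda>z. z)" "F 2 = (\<lambda>z. \<i> * z)" "F 3 = (\<lambda>z. of_real (2 / cos 1))"
    by (simp_all add: F_def)
  have d: "deriv (F 1) z = 1" "deriv (F 2) z = \<i>" "deriv (F 3) z = 0" for z
    by (auto simp: F intro!: DERIV_imp_deriv derivative_eq_intros)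
  have c: "cos (1::real) \<noteq> 0" using cos_level_pos[of 0] by (simp add: level_def)
  have "F j holomorphic_on UNIV" for j
    using exhaust_3[of j] by (auto simp: F intro!: holomorphic_intros)
  moreover have "0 \<le> height 0 F z" if "norm z \<le> 2" for z
  proof -
    have "sin 1 * Re z \<le> \<bar>sin 1\<bar> * \<bar>Re z\<bar>" by (metis abs_ge_self abs_mult)
    also have "\<dots> \<le> 1 * 2"
      using abs_Re_le_cmod[of z] that by (intro mult_mono) auto
    finally show ?thesis using c by (simp add: height_def F level_def)
  qed
  ultimately have "stage 0 F" by (simp add: stage_def speed_def d)
  then show ?thesis by blast
qed

text \<open>Here \<open>u\<close> is the component of \<open>(x, y, w)\<close> along
  \<open>(c, 0, s)\<close>, and \<open>(P, Q)\<close> is the change of \<open>(u, y)\<close> under a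
  rotation by a complex angle with cosine \<open>C\<close> and sine \<open>S\<close>. The rotation
  preserves the quadratic form and is invertible.\<close>

lemma null_rotation:
  fixes x y w C S u P Q :: complex and c s :: real
  assumes cs: "c\<^sup>2 + s\<^sup>2 = 1" and CS: "C\<^sup>2 + S\<^sup>2 = 1"
  defines "u \<equiv> c * x + s * w"
  defines "P \<equiv> u * (C - 1) - y * S" and "Q \<equiv> u * S + y * (C - 1)"
  shows "(x + c * P)\<^sup>2 + (y + Q)\<^sup>2 + (w + s * P)\<^sup>2 = x\<^sup>2 + y\<^sup>2 + w\<^sup>2"
    and "x + c * P = 0 \<Longrightarrow> y + Q = 0 \<Longrightarrow> w + s * P = 0 \<Longrightarrow> x = 0 \<and> y = 0 \<and> w = 0"
proof -
  have cs': "(of_real c)\<^sup>2 + (of_real s)\<^sup>2 = (1::complex)"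
    using arg_cong[OF cs, of complex_of_real] by simp
  have uP: "u + P = u * C - y * S" and vQ: "y + Q = u * S + y * C"
    by (simp_all add: P_def Q_def algebra_simps)
  have "(x + c * P)\<^sup>2 + (y + Q)\<^sup>2 + (w + s * P)\<^sup>2
      = x\<^sup>2 + w\<^sup>2 + 2 * P * u + P\<^sup>2 * ((of_real c)\<^sup>2 + (of_real s)\<^sup>2) + (y + Q)\<^sup>2"
    unfolding u_def by (simp add: power2_eq_square algebra_simps)
  also have "\<dots> = x\<^sup>2 + w\<^sup>2 - u\<^sup>2 + ((u + P)\<^sup>2 + (y + Q)\<^sup>2)"
    unfolding cs' by (simp add: power2_eq_square algebra_simps)
  also have "(u + P)\<^sup>2 + (y + Q)\<^sup>2 = (u\<^sup>2 + y\<^sup>2) * (C\<^sup>2 + S\<^sup>2)"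
    unfolding uP vQ by (simp add: power2_eq_square algebra_simps)
  finally show "(x + c * P)\<^sup>2 + (y + Q)\<^sup>2 + (w + s * P)\<^sup>2 = x\<^sup>2 + y\<^sup>2 + w\<^sup>2"
    using CS by simp
  assume z: "x + c * P = 0" "y + Q = 0" "w + s * P = 0"
  have "u + P = u + P * ((of_real c)\<^sup>2 + (of_real s)\<^sup>2)" unfolding cs' by simp
  also have "\<dots> = c * (x + c * P) + s * (w + s * P)"
    unfolding u_def by (simp add: power2_eq_square algebra_simps)
  finally have 1: "u * C - y * S = 0" using z uP by simp
  have 2: "u * S + y * C = 0" using z vQ by simp
  \<comment> \<open>The inverse rotation is applied to the rotated pair, which is zero.\<close>
  have "u = u * (C\<^sup>2 + S\<^sup>2)" using CS by simp
  also have "\<dots> = C * (u * C - y * S) + S * (u * S + y * C)"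
    by (simp add: power2_eq_square algebra_simps)
  finally have u0: "u = 0" using 1 2 by simp
  have "y = y * (C\<^sup>2 + S\<^sup>2)" using CS by simp
  also have "\<dots> = C * (u * S + y * C) - S * (u * C - y * S)"
    by (simp add: power2_eq_square algebra_simps)
  finally have v0: "y = 0" using 1 2 by simp
  have "P = 0" using u0 v0 by (simp add: P_def)
  then show "x = 0 \<and> y = 0 \<and> w = 0" using z v0 by simp
qed

text \<open>The pair to rotate consists of the derivative along the line of stage \<open>k\<close>
  and \<open>deriv (F 2)\<close>. The next line is less steep, so a long displacement along the
  present one raises the next height.\<close>

lemma stage_Suc:
  assumes F: "stage k F"
  shows "\<exists>G. stage (Suc k) G \<and> refines k F G"
proof -
  define \<alpha> where "\<alpha> = level k"
  define \<alpha>' where "\<alpha>' = level (Suc k)"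
  define c where "c = cos \<alpha>"
  define s where "s = sin \<alpha>"
  have cs: "c\<^sup>2 + s\<^sup>2 = 1" "\<bar>c\<bar> \<le> 1" "\<bar>s\<bar> \<le> 1" by (simp_all add: c_def s_def)
  have hol: "F j holomorphic_on UNIV" for j using F by (simp add: stage_def)
  have dF: "(F j has_field_derivative deriv (F j) z) (at z)" for j z
    by (rule holomorphic_derivI[OF hol open_UNIV]) simp
  have hd: "deriv (F j) holomorphic_on UNIV" for j by (intro holomorphic_deriv hol open_UNIV)
  have null: "(deriv (F 1) z)\<^sup>2 + (deriv (F 2) z)\<^sup>2 + (deriv (F 3) z)\<^sup>2 = 0" for z
    using F by (simp add: stage_def)
  have pos: "speed F z > 0" for z using F by (simp add: stage_def)
  have f2: "deriv (F 2) \<i> \<noteq> 0" using F by (simp add: stage_def)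
  obtain B1 where B1: "\<And>z. norm z \<le> 2 \<Longrightarrow> norm (F 1 z) \<le> B1" using entire_bounded_disc[OF hol] by blast
  obtain B3 where B3: "\<And>z. norm z \<le> 2 \<Longrightarrow> norm (F 3 z) \<le> B3" using entire_bounded_disc[OF hol] by blast
  \<comment> \<open>Sine of the angle between consecutive lines: a displacement \<open>P\<close>
    along the line of stage \<open>k\<close> adds \<open>\<sigma> * Re (P z)\<close> to
    \<open>height (Suc k)\<close>.\<close>
  define \<sigma> where "\<sigma> = sin (\<alpha> - \<alpha>')"
  have \<sigma>: "\<sigma> > 0" unfolding \<sigma>_def
  proof (rule sin_gt_zero)
    show "\<alpha> - \<alpha>' > 0" using level(3)[of k] by (simp add: \<alpha>_def \<alpha>'_def)
    show "\<alpha> - \<alpha>' < pi" using level(2)[of k] level(1)[of "Suc k"] pi_gt3 by (simp add: \<alpha>_def \<alpha>'_def)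
  qed
  define u where "u z = c * deriv (F 1) z + s * deriv (F 3) z" for z
  have hu: "u holomorphic_on UNIV" unfolding u_def[abs_def] by (intro holomorphic_intros hd)
  \<comment> \<open>The first bound serves the three components of the speed and the closeness
    \<open>(1/2)^k\<close>; the second keeps \<open>deriv (G 2) \<i>\<close> away from 0.\<close>
  define \<epsilon> where "\<epsilon> = min ((1/2)^(k+2) / 3) (norm (deriv (F 2) \<i>) / (speed F \<i> + 1))"
  have \<epsilon>: "\<epsilon> > 0" "3 * \<epsilon> \<le> (1/2)^(k+2)" "\<epsilon> \<le> (1/2)^k" "speed F \<i> * \<epsilon> < norm (deriv (F 2) \<i>)"
  proof -
    show "\<epsilon> > 0" using f2 pos[of \<i>] by (simp add: \<epsilon>_def)
    show 1: "3 * \<epsilon> \<le> (1/2)^(k+2)" by (simp add: \<epsilon>_def)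
    have "(1/2)^(k+2) \<le> (1/2::real)^k" by (simp add: power_decreasing)
    then show "\<epsilon> \<le> (1/2)^k" using 1 \<open>\<epsilon> > 0\<close> by linarith
    have "\<epsilon> \<le> norm (deriv (F 2) \<i>) / (speed F \<i> + 1)" by (simp add: \<epsilon>_def)
    then have "\<epsilon> * (speed F \<i> + 1) \<le> norm (deriv (F 2) \<i>)" using pos[of \<i>] by (simp add: pos_le_divide_eq)
    then show "speed F \<i> * \<epsilon> < norm (deriv (F 2) \<i>)" using \<open>\<epsilon> > 0\<close> by (simp add: algebra_simps)
  qed
  \<comment> \<open>The gain, once multiplied by \<open>\<sigma>\<close>, outweighs the bounds of
    \<open>F 1\<close> and \<open>F 3\<close> on the disc and still leaves
    \<open>Suc k\<close>.\<close>
  obtain \<theta> P Q where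
    P: "\<And>z. (P has_field_derivative u z * (cos (\<theta> z) - 1) - deriv (F 2) z * sin (\<theta> z)) (at z)" and
    Q: "\<And>z. (Q has_field_derivative u z * sin (\<theta> z) + deriv (F 2) z * (cos (\<theta> z) - 1)) (at z)" and
    \<theta>: "\<And>z. norm z \<le> 2 \<Longrightarrow> level k \<le> Im z \<Longrightarrow> norm (cos (\<theta> z) - 1) \<le> \<epsilon> \<and> norm (sin (\<theta> z)) \<le> \<epsilon>" and
    PQ: "\<And>z. norm z \<le> 2 \<Longrightarrow> level k \<le> Im z \<Longrightarrow> norm (P z) \<le> \<epsilon> \<and> norm (Q z) \<le> \<epsilon>" and
    gain: "\<And>z. norm z \<le> 2 \<Longrightarrow> Im z \<le> level (Suc k) \<Longrightarrow> Re (P z) \<ge> (Suc k + B1 + B3) / \<sigma>"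
    using rotation_step[OF hu hd f2 level(1) level(3) level(2) \<epsilon>(1), of k "(Suc k + B1 + B3) / \<sigma>"] by metis
  define dP where "dP z = u z * (cos (\<theta> z) - 1) - deriv (F 2) z * sin (\<theta> z)" for z
  define dQ where "dQ z = u z * sin (\<theta> z) + deriv (F 2) z * (cos (\<theta> z) - 1)" for z
  define G :: "3 \<Rightarrow> complex \<Rightarrow> complex" where
    "G j = (if j = 1 then (\<lambda>z. F 1 z + c * P z) else if j = 2 then (\<lambda>z. F 2 z + Q z)
            else (\<lambda>z. F 3 z + s * P z))" for j
  have G: "G 1 = (\<lambda>z. F 1 z + c * P z)" "G 2 = (\<lambda>z. F 2 z + Q z)" "G 3 = (\<lambda>z. F 3 z + s * P z)"
    by (simp_all add: G_def)
  have dG: "(G 1 has_field_derivative deriv (F 1) z + c * dP z) (at z)"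
    "(G 2 has_field_derivative deriv (F 2) z + dQ z) (at z)"
    "(G 3 has_field_derivative deriv (F 3) z + s * dP z) (at z)" for z
    unfolding G dP_def dQ_def by (auto intro!: derivative_eq_intros dF P Q)
  note dG' = DERIV_imp_deriv[OF dG(1)] DERIV_imp_deriv[OF dG(2)] DERIV_imp_deriv[OF dG(3)]
  note rot = null_rotation[OF cs(1), where C = "cos (\<theta> z)" and S = "sin (\<theta> z)" and x = "deriv (F 1) z"
      and y = "deriv (F 2) z" and w = "deriv (F 3) z" for z, OF sin_cos_squared_add2, folded u_def, folded dP_def dQ_def]
  have Ghol: "G j holomorphic_on UNIV" for j
  proof -
    have "\<exists>D. (G j has_field_derivative D) (at z)" for z using dG[of z] exhaust_3[of j] by auto
    then show ?thesis by (simp add: holomorphic_on_open)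
  qed
  have Gspeed: "speed G z > 0" for z
  proof (rule ccontr)
    assume "\<not> speed G z > 0"
    then have "norm (deriv (G 1) z) = 0" "norm (deriv (G 2) z) = 0" "norm (deriv (G 3) z) = 0"
      unfolding speed_def
      using norm_ge_zero[of "deriv (G 1) z"] norm_ge_zero[of "deriv (G 2) z"] norm_ge_zero[of "deriv (G 3) z"]
      by linarith+
    then have "speed F z = 0" using rot(2)[of z] by (simp add: dG' speed_def)
    then show False using pos[of z] by simp
  qed
  have nu: "norm (u z) \<le> norm (deriv (F 1) z) + norm (deriv (F 3) z)" for z
  proof -
    have "norm (u z) \<le> norm (c * deriv (F 1) z) + norm (s * deriv (F 3) z)"
      unfolding u_def by (rule norm_triangle_ineq)
    also have "\<dots> \<le> norm (deriv (F 1) z) + norm (deriv (F 3) z)"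
      unfolding norm_mult using cs by (intro add_mono mult_left_le_one_le) auto
    finally show ?thesis .
  qed
  have dPQ: "norm (dP z) \<le> speed F z * \<epsilon>" "norm (dQ z) \<le> speed F z * \<epsilon>"
    if z: "norm z \<le> 2" "level k \<le> Im z" for z
  proof -
    have *: "norm (u z * w1) + norm (deriv (F 2) z * w2) \<le> speed F z * \<epsilon>"
      if "norm w1 \<le> \<epsilon>" "norm w2 \<le> \<epsilon>" for w1 w2
    proof -
      have "norm (u z * w1) + norm (deriv (F 2) z * w2) \<le> norm (u z) * \<epsilon> + norm (deriv (F 2) z) * \<epsilon>"
        unfolding norm_mult using that by (intro add_mono mult_left_mono) auto
      also have "\<dots> = (norm (u z) + norm (deriv (F 2) z)) * \<epsilon>" by (simp add: distrib_right)
      also have "\<dots> \<le> speed F z * \<epsilon>"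
        unfolding speed_def using nu[of z] \<epsilon>(1) by (intro mult_right_mono) auto
      finally show ?thesis .
    qed
    show "norm (dP z) \<le> speed F z * \<epsilon>" unfolding dP_def
      by (rule order_trans[OF norm_triangle_ineq4]) (use * \<theta>[OF z] in auto)
    show "norm (dQ z) \<le> speed F z * \<epsilon>" unfolding dQ_def
      by (rule order_trans[OF norm_triangle_ineq]) (use * \<theta>[OF z] in auto)
  qed
  have mult: "norm (of_real r * w) \<le> norm w" if "\<bar>r\<bar> \<le> 1" for r :: real and w :: complex
    unfolding norm_mult using that by (intro mult_left_le_one_le) auto
  have "stage (Suc k) G"
    unfolding stage_def
  proof (intro conjI allI impI)
    show "(deriv (G 1) z)\<^sup>2 + (deriv (G 2) z)\<^sup>2 + (deriv (G 3) z)\<^sup>2 = 0" for z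
      unfolding dG' using rot(1)[of z] null[of z] by simp
    show "deriv (G 2) \<i> \<noteq> 0"
    proof
      assume "deriv (G 2) \<i> = 0"
      then have "norm (deriv (F 2) \<i>) = norm (dQ \<i>)"
        unfolding dG' by (metis add_eq_0_iff norm_minus_cancel)
      also have "\<dots> \<le> speed F \<i> * \<epsilon>" by (rule dPQ) (use level(2) in auto)
      finally show False using \<epsilon>(4) by simp
    qed
    fix z assume z: "norm z \<le> 2 \<and> Im z \<le> level (Suc k)"
    have "height (Suc k) G z = (cos \<alpha>' * Re (F 3 z) - sin \<alpha>' * Re (F 1 z)) + \<sigma> * Re (P z)"
      unfolding height_def G \<sigma>_def sin_diff c_def s_def \<alpha>'_def[symmetric] by (simp add: algebra_simps)
    moreover have "\<sigma> * Re (P z) \<ge> Suc k + B1 + B3"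
    proof -
      have "(Suc k + B1 + B3) / \<sigma> \<le> Re (P z)" using gain z by blast
      then show ?thesis using \<sigma> by (simp add: pos_divide_le_eq mult.commute)
    qed
    moreover have "\<bar>cos \<alpha>' * Re (F 3 z)\<bar> \<le> B3"
    proof -
      have "\<bar>cos \<alpha>' * Re (F 3 z)\<bar> \<le> 1 * norm (F 3 z)"
        unfolding abs_mult by (intro mult_mono abs_Re_le_cmod) auto
      then show ?thesis using B3 z by force
    qed
    moreover have "\<bar>sin \<alpha>' * Re (F 1 z)\<bar> \<le> B1"
    proof -
      have "\<bar>sin \<alpha>' * Re (F 1 z)\<bar> \<le> 1 * norm (F 1 z)"
        unfolding abs_mult by (intro mult_mono abs_Re_le_cmod) auto
      then show ?thesis using B1 z by force
    qed
    ultimately show "real (Suc k) \<le> height (Suc k) G z" by linarith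
  qed (rule Ghol Gspeed)+
  moreover have "refines k F G"
    unfolding refines_def
  proof (intro conjI allI impI)
    show "height k G z = height k F z" for z
      unfolding height_def G c_def s_def \<alpha>_def by (simp add: algebra_simps)
    fix z assume "norm z \<le> 2 \<and> level k \<le> Im z"
    then have z: "norm z \<le> 2" "level k \<le> Im z" by auto
    show "norm (G j z - F j z) \<le> (1/2)^k" for j
    proof -
      have "norm (G j z - F j z) \<le> \<epsilon>"
        using exhaust_3[of j] PQ[OF z] order_trans[OF mult[OF cs(2)], of "P z"] order_trans[OF mult[OF cs(3)], of "P z"]
        by (auto simp: G)
      then show ?thesis using \<epsilon>(3) by simp
    qed
    have tri: "norm a - norm b \<le> norm (a + b)" for a b :: complex
      by (rule norm_diff_ineq)
    have "speed F z - 3 * (speed F z * \<epsilon>) \<le> speed G z"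
      using tri[of "deriv (F 1) z" "c * dP z"] tri[of "deriv (F 2) z" "dQ z"] tri[of "deriv (F 3) z" "s * dP z"]
        mult[OF cs(2), of "dP z"] mult[OF cs(3), of "dP z"] dPQ[OF z]
      unfolding speed_def[of G] dG' speed_def[of F] by linarith
    moreover have "(3 * \<epsilon>) * speed F z \<le> (1/2)^(k+2) * speed F z"
      using \<epsilon>(2) pos[of z] by (intro mult_right_mono) auto
    ultimately show "(1 - (1/2)^(k+2)) * speed F z \<le> speed G z"
      by (simp add: algebra_simps)
  qed
  ultimately show ?thesis by blast
qed

section \<open>Passage to the limit\<close>

text \<open>Geometric tails are summable. The start \<open>m\<close> is there because a point of the
  half disc is under control only once the strips have dropped below it.\<close>

lemma geometric_increments:
  fixes x :: "nat \<Rightarrow> complex"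
  assumes "\<And>k. k \<ge> m \<Longrightarrow> norm (x (Suc k) - x k) \<le> (1/2)^k"
  shows "convergent x" and "k \<ge> m \<Longrightarrow> norm (lim x - x k) \<le> 2 * (1/2)^k"
proof -
  have bound: "norm (x (k + n) - x k) \<le> 2 * (1/2)^k - 2 * (1/2)^(k + n)" if "k \<ge> m" for k n
  proof (induction n)
    case (Suc n)
    have "norm (x (k + Suc n) - x k) \<le> norm (x (Suc (k + n)) - x (k + n)) + norm (x (k + n) - x k)"
      using norm_triangle_ineq[of "x (Suc (k + n)) - x (k + n)" "x (k + n) - x k"] by simp
    also have "\<dots> \<le> (1/2)^(k + n) + (2 * (1/2)^k - 2 * (1/2)^(k + n))"
      using assms[of "k + n"] that by (intro add_mono Suc.IH) auto
    finally show ?case by simp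
  qed simp
  have le: "norm (x n - x k) \<le> 2 * (1/2)^k" if "m \<le> k" "k \<le> n" for k n
  proof -
    have "(0::real) \<le> (1/2)^n" by simp
    moreover have "norm (x n - x k) \<le> 2 * (1/2)^k - 2 * (1/2)^n"
      using bound[OF that(1), of "n - k"] that by simp
    ultimately show ?thesis by linarith
  qed
  have "Cauchy x"
  proof (rule metric_CauchyI)
    fix e :: real assume e: "e > 0"
    have "(\<lambda>k. 4 * (1/2::real)^k) \<longlonglongrightarrow> 4 * 0"
      by (intro tendsto_intros LIMSEQ_realpow_zero) auto
    then have "eventually (\<lambda>k. 4 * (1/2::real)^k < e \<and> k \<ge> m) sequentially"
      using e by (intro eventually_conj order_tendstoD(2) eventually_ge_at_top) auto
    then obtain k where k: "4 * (1/2::real)^k < e" "k \<ge> m" by (auto simp: eventually_sequentially)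
    have "dist (x i) (x j) < e" if "i \<ge> k" "j \<ge> k" for i j
      using dist_triangle2[of "x i" "x j" "x k"] le[OF k(2) that(1)] le[OF k(2) that(2)] k(1)
      by (simp add: dist_norm)
    then show "\<exists>M. \<forall>i\<ge>M. \<forall>j\<ge>M. dist (x i) (x j) < e" by blast
  qed
  then show conv: "convergent x" by (simp add: Cauchy_convergent_iff)
  assume k: "k \<ge> m"
  have "(\<lambda>n. norm (x n - x k)) \<longlonglongrightarrow> norm (lim x - x k)"
    using conv by (intro tendsto_intros) (simp add: convergent_LIMSEQ_iff)
  then show "norm (lim x - x k) \<le> 2 * (1/2)^k"
    by (rule tendsto_upperbound) (use le k in \<open>auto simp: eventually_sequentially\<close>)
qed

text \<open>The factors \<open>1 - (1/2)^(k+2)\<close> multiply to at least \<open>1/2\<close>; the extra term \<open>(1/2)^k\<close> makes the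
  induction go through.\<close>

lemma half_product_bound:
  fixes a :: "nat \<Rightarrow> real"
  assumes "\<And>k. k \<ge> m \<Longrightarrow> (1 - (1/2)^(k+2)) * a k \<le> a (Suc k)" "a m \<ge> 0" "k \<ge> m"
  shows "(1 + (1/2)^k) / 2 * a m \<le> a k"
  using assms(3)
proof (induction k rule: dec_induct)
  case base
  have "(1/2::real)^m \<le> 1" by (simp add: power_le_one)
  then have "(1 + (1/2)^m) / 2 * a m \<le> 1 * a m" using assms(2) by (intro mult_right_mono) auto
  then show ?case by simp
next
  case (step k)
  define h where "h = (1/2::real)^k"
  have h: "0 < h" "h \<le> 1" by (simp_all add: h_def power_le_one)
  have "h * h \<le> h" using h by (intro mult_left_le) auto
  then have "(1 + h / 2) / 2 \<le> (1 - h / 4) * ((1 + h) / 2)"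
    by (simp add: field_simps)
  then have "(1 + h / 2) / 2 * a m \<le> (1 - h / 4) * ((1 + h) / 2) * a m"
    using assms(2) by (rule mult_right_mono)
  also have "\<dots> \<le> (1 - h / 4) * a k"
    using step.IH h by (simp only: mult.assoc) (intro mult_left_mono, auto simp: h_def)
  also have "\<dots> \<le> a (Suc k)" using assms(1)[OF step.hyps(1)] by (simp add: h_def)
  finally show ?case by (simp add: h_def)
qed

text \<open>Each point of \<open>U\<close> has a neighbourhood above some \<open>level m\<close>,
  where the increments are geometric from index \<open>m\<close> on. So the stages converge locally
  uniformly, together with their derivatives.\<close>

lemma limit_map:
  defines "U \<equiv> {z. norm z < 2 \<and> Im z > 0}"
  obtains L where
    "\<And>j. L j holomorphic_on U"
    "\<And>z. z \<in> U \<Longrightarrow> (deriv (L 1) z)\<^sup>2 + (deriv (L 2) z)\<^sup>2 + (deriv (L 3) z)\<^sup>2 = 0"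
    "\<And>z. z \<in> U \<Longrightarrow> \<exists>j. deriv (L j) z \<noteq> 0"
    "\<And>k z. norm z < 2 \<Longrightarrow> level (Suc k) \<le> Im z \<Longrightarrow> Im z \<le> level k \<Longrightarrow> real k - 2 \<le> height k L z"
proof -
  obtain F where F: "\<And>k. stage k (F k)" "\<And>k. refines k (F k) (F (Suc k))"
    using dependent_nat_choice[of stage refines, OF stage_0 stage_Suc] by blast
  have oU: "open U" unfolding U_def
    by (intro open_Collect_conj open_Collect_less continuous_intros)
  have incr: "norm (F (Suc k) j z - F k j z) \<le> (1/2)^k" if "norm z \<le> 2" "level m \<le> Im z" "k \<ge> m" for k m j z
    using F(2)[of k] that level_antimono[OF that(3)] unfolding refines_def by (meson order_trans)
  define L where "L j z = lim (\<lambda>k. F k j z)" for j z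
  have L: "norm (L j z - F k j z) \<le> 2 * (1/2)^k" if "norm z \<le> 2" "level m \<le> Im z" "k \<ge> m" for j k m z
    unfolding L_def by (rule geometric_increments(2)[where m = m]) (use incr that in auto)
  have unif: "\<exists>d. 0 < d \<and> cball x d \<subseteq> U \<and> uniform_limit (cball x d) (\<lambda>k. F k j) (L j) sequentially"
    if x: "x \<in> U" for x j
  proof -
    obtain d0 where d0: "d0 > 0" "cball x d0 \<subseteq> U" using oU x open_contains_cball by blast
    \<comment> \<open>Radius at most \<open>Im x / 2\<close> keeps the disc above the height
      \<open>Im x / 2\<close>, hence above \<open>level m\<close>.\<close>
    define d where "d = min d0 (Im x / 2)"
    have d: "d > 0" "cball x d \<subseteq> U" using d0 x by (auto simp: d_def U_def)
    obtain m where m: "level m \<le> Im x / 2" using exists_level_le[of "Im x / 2"] x by (auto simp: U_def)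
    have im: "level m \<le> Im w" "norm w \<le> 2" if "w \<in> cball x d" for w
    proof -
      have "\<bar>Im x - Im w\<bar> \<le> Im x / 2"
        using abs_Im_le_cmod[of "x - w"] that by (auto simp: d_def dist_norm)
      then show "level m \<le> Im w" using m by linarith
      show "norm w \<le> 2" using d(2) that by (force simp: U_def)
    qed
    have "uniform_limit (cball x d) (\<lambda>k. F k j) (L j) sequentially"
      unfolding uniform_limit_iff
    proof (intro allI impI)
      fix e :: real assume e: "e > 0"
      have "(\<lambda>k. 2 * (1/2::real)^k) \<longlonglongrightarrow> 2 * 0"
        by (intro tendsto_intros LIMSEQ_realpow_zero) auto
      then have "eventually (\<lambda>k. 2 * (1/2::real)^k < e \<and> k \<ge> m) sequentially"
        using e by (intro eventually_conj order_tendstoD(2) eventually_ge_at_top) auto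
      then show "\<forall>\<^sub>F k in sequentially. \<forall>w\<in>cball x d. dist (F k j w) (L j w) < e"
      proof eventually_elim
        case (elim k)
        then show ?case
          using L[OF im(2) im(1), of _ k j] by (force simp: dist_norm norm_minus_commute)
      qed
    qed
    then show ?thesis using d by blast
  qed
  have Fhol: "F k j holomorphic_on S" for k j S
    using F(1)[of k] holomorphic_on_subset[of "F k j" UNIV S] by (simp add: stage_def)
  have Lhol: "L j holomorphic_on U" for j
    by (rule holomorphic_uniform_sequence[OF oU, of "\<lambda>k. F k j"]) (use Fhol unif in auto)
  have dlim: "(\<lambda>k. deriv (F k j) z) \<longlonglongrightarrow> deriv (L j) z" if z: "z \<in> U" for j z
  proof -
    have "\<exists>g'. \<forall>x\<in>U. (L j has_field_derivative g' x) (at x) \<and> (\<lambda>k. deriv (F k j) x) \<longlonglongrightarrow> g' x"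
      by (rule has_complex_derivative_uniform_sequence[OF oU])
         (use Fhol unif in \<open>auto intro: holomorphic_derivI[OF _ open_UNIV]\<close>)
    then show ?thesis using z DERIV_imp_deriv by metis
  qed
  have null: "(deriv (L 1) z)\<^sup>2 + (deriv (L 2) z)\<^sup>2 + (deriv (L 3) z)\<^sup>2 = 0" if z: "z \<in> U" for z
  proof -
    have "(\<lambda>k. (deriv (F k 1) z)\<^sup>2 + (deriv (F k 2) z)\<^sup>2 + (deriv (F k 3) z)\<^sup>2)
        \<longlonglongrightarrow> (deriv (L 1) z)\<^sup>2 + (deriv (L 2) z)\<^sup>2 + (deriv (L 3) z)\<^sup>2"
      by (intro tendsto_intros dlim z)
    moreover have "(\<lambda>k. (deriv (F k 1) z)\<^sup>2 + (deriv (F k 2) z)\<^sup>2 + (deriv (F k 3) z)\<^sup>2) = (\<lambda>k. 0)"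
      using F(1) by (auto simp: stage_def)
    ultimately show ?thesis by (simp add: LIMSEQ_const_iff)
  qed
  \<comment> \<open>A limit of nonzero null vectors might vanish; the speed bounds preserve at least
    half of the speed of stage \<open>m\<close>.\<close>
  have nz: "\<exists>j. deriv (L j) z \<noteq> 0" if z: "z \<in> U" for z
  proof (rule ccontr)
    assume "\<not> ?thesis"
    then have "speed L z = 0" by (simp add: speed_def)
    obtain m where m: "level m \<le> Im z" using exists_level_le[of "Im z"] z by (auto simp: U_def)
    have pos: "speed (F m) z > 0" using F(1)[of m] by (simp add: stage_def)
    have lower: "speed (F m) z / 2 \<le> speed (F k) z" if "k \<ge> m" for k
    proof -
      have "(1 + (1/2)^k) / 2 * speed (F m) z \<le> speed (F k) z"
      proof (rule half_product_bound[OF _ _ that])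
        show "(1 - (1/2)^(i+2)) * speed (F i) z \<le> speed (F (Suc i)) z" if "i \<ge> m" for i
          using F(2)[of i] level_antimono[OF that] m z unfolding refines_def U_def by simp
      qed (use pos in simp)
      moreover have "1 / 2 * speed (F m) z \<le> (1 + (1/2)^k) / 2 * speed (F m) z"
        using pos by (intro mult_right_mono) auto
      ultimately show ?thesis by simp
    qed
    have "(\<lambda>k. speed (F k) z) \<longlonglongrightarrow> speed L z"
      unfolding speed_def by (intro tendsto_intros dlim z)
    then have "speed (F m) z / 2 \<le> speed L z"
      by (rule tendsto_lowerbound) (use lower in \<open>auto simp: eventually_sequentially\<close>)
    then show False using pos \<open>speed L z = 0\<close> by simp
  qed
  show ?thesis
  proof (rule that[of L])
    fix k and z :: complex
    assume z: "norm z < 2" "level (Suc k) \<le> Im z" "Im z \<le> level k"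
    have "real k \<le> height k (F k) z" using F(1)[of k] z by (simp add: stage_def)
    \<comment> \<open>The step from \<open>F k\<close> to \<open>F (Suc k)\<close> is the last one
      without control on this strip, and it preserves \<open>height k\<close>. All later steps
      together move each component by at most 1, which costs at most 2 in height.\<close>
    then have k: "real k \<le> height k (F (Suc k)) z" using F(2)[of k] by (simp add: refines_def)
    have "\<bar>Re (L j z) - Re (F (Suc k) j z)\<bar> \<le> 1" for j
    proof -
      have "norm (L j z - F (Suc k) j z) \<le> 2 * (1/2)^(Suc k)" using z by (intro L) auto
      also have "\<dots> \<le> 1" by (simp add: power_le_one)
      finally show ?thesis using abs_Re_le_cmod[of "L j z - F (Suc k) j z"] by simp
    qed
    then have "\<bar>cos (level k) * (Re (L 3 z) - Re (F (Suc k) 3 z))\<bar> \<le> 1 * 1"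
      "\<bar>sin (level k) * (Re (L 1 z) - Re (F (Suc k) 1 z))\<bar> \<le> 1 * 1"
      unfolding abs_mult by (intro mult_mono; simp)+
    moreover have "height k L z - height k (F (Suc k)) z
        = cos (level k) * (Re (L 3 z) - Re (F (Suc k) 3 z)) - sin (level k) * (Re (L 1 z) - Re (F (Suc k) 1 z))"
      by (simp add: height_def algebra_simps)
    ultimately show "real k - 2 \<le> height k L z" using k by linarith
  qed (use Lhol null nz in auto)
qed

section \<open>Properness and the lower bound\<close>

lemma exists_level_between:
  assumes "0 < y" "y \<le> 1"
  obtains k where "level (Suc k) \<le> y" "y \<le> level k"
proof -
  obtain m where m: "level m \<le> y" using exists_level_le[OF assms(1)] by blast
  define n where "n = (LEAST n. level n \<le> y)"
  have n: "level n \<le> y" unfolding n_def by (rule LeastI[of _ m]) (rule m)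
  show ?thesis
  proof (cases n)
    case 0
    then have "y = level 0" using n assms by (simp add: level_def)
    then show ?thesis using that[of 0] level(3)[of 0] by simp
  next
    case (Suc k)
    then have "k < (LEAST n. level n \<le> y)" by (simp add: n_def)
    then have "\<not> level k \<le> y" by (rule not_less_Least)
    then show ?thesis using that[of k] n Suc by simp
  qed
qed

text \<open>These sets exhaust the half disc, whose only missing limit points are real; so a
  divergent sequence eventually falls below every positive height.\<close>

lemma compact_half_disc_above: "compact (half_disc \<inter> {z. b \<le> Im z})" if "b > 0"
proof -
  have "half_disc \<inter> {z. b \<le> Im z} = cball 0 1 \<inter> {z. b \<le> Im z}"
    using that by (auto simp: half_disc_def)
  also have "compact \<dots>"
    by (intro compact_Int_closed closed_Collect_le continuous_intros) auto
  finally show ?thesis .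
qed

theorem mainTheorem4:
  "\<exists>X :: complex \<Rightarrow> real^3.
     conformal_minimal_immersion_on half_disc X \<and>
     proper_on half_disc (\<lambda>z. (X z $ 1, X z $ 3)) \<and>
     (\<forall>p. divergent_in half_disc p \<longrightarrow>
        (\<lambda>n. min (X (p n) $ 3 / (\<bar>X (p n) $ 1\<bar> + 1)) 0) \<longlonglongrightarrow> 0)"
proof -
  \<comment> \<open>The boundary arc of the half disc is interior to \<open>U\<close>, so the map is
    its own smooth extension.\<close>
  define U where "U = {z::complex. norm z < 2 \<and> Im z > 0}"
  obtain L where L: "\<And>j. L j holomorphic_on U"
    "\<And>z. z \<in> U \<Longrightarrow> (deriv (L 1) z)\<^sup>2 + (deriv (L 2) z)\<^sup>2 + (deriv (L 3) z)\<^sup>2 = 0"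
    "\<And>z. z \<in> U \<Longrightarrow> \<exists>j. deriv (L j) z \<noteq> 0"
    "\<And>k z. norm z < 2 \<Longrightarrow> level (Suc k) \<le> Im z \<Longrightarrow> Im z \<le> level k \<Longrightarrow> real k - 2 \<le> height k L z"
    using limit_map[folded U_def] by blast
  have oU: "open U" unfolding U_def
    by (intro open_Collect_conj open_Collect_less continuous_intros)
  have sub: "half_disc \<subseteq> U" by (auto simp: half_disc_def U_def)
  define X where "X = re_part L"
  have X: "X z $ j = Re (L j z)" for z j by (simp add: X_def)
  \<comment> \<open>A point below \<open>level m\<close> lies in a strip \<open>k\<close> with
    \<open>level (Suc k) < level m\<close>, which forces \<open>k \<ge> m\<close>.\<close>
  have near: "\<exists>k\<ge>m. real k - 2 \<le> cos (level k) * X z $ 3 - sin (level k) * X z $ 1"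
    if z: "z \<in> half_disc" "Im z < level m" for z m
  proof -
    have "Im z \<le> 1" "0 < Im z" "norm z < 2"
      using z abs_Im_le_cmod[of z] by (auto simp: half_disc_def)
    then obtain k where k: "level (Suc k) \<le> Im z" "Im z \<le> level k" using exists_level_between by metis
    have "level (Suc k) < level m" using k z by simp
    then have "m < Suc k" using level_antimono[of "Suc k" m] by (meson not_less)
    moreover have "real k - 2 \<le> height k L z" using L(4) k \<open>norm z < 2\<close> by blast
    ultimately show ?thesis by (intro exI[of _ k]) (simp add: height_def X)
  qed
  have "conformal_minimal_immersion_on half_disc X"
    unfolding X_def by (rule conformal_minimal_immersion_on_re_part[OF oU sub L(1)]) (use L sub in auto)
  moreover have "proper_on half_disc (\<lambda>z. (X z $ 1, X z $ 3))"
    unfolding proper_on_def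
  proof (intro conjI allI impI)
    show cont: "continuous_on half_disc (\<lambda>z. (X z $ 1, X z $ 3))"
      unfolding X by (intro continuous_intros holomorphic_on_imp_continuous_on holomorphic_on_subset[OF L(1) sub])
    fix K :: "(real \<times> real) set" assume K: "compact K"
    have "\<exists>R. \<forall>q\<in>K. norm q \<le> R"
      using compact_imp_bounded[OF K] by (simp add: bounded_iff)
    then obtain R where R: "\<And>q. q \<in> K \<Longrightarrow> norm q \<le> R" by blast
    \<comment> \<open>On the preimage of \<open>K\<close> every height is at most
      \<open>2 * R\<close>, whereas below \<open>level m\<close> some height is at least
      \<open>m - 2\<close>.\<close>
    obtain m where m: "real m > 2 * R + 2" using reals_Archimedean2 by blast
    define C where "C = half_disc \<inter> {z. level m \<le> Im z}"
    have C: "compact C" unfolding C_def by (rule compact_half_disc_above[OF level(1)])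
    have "Im z \<ge> level m" if z: "z \<in> half_disc" "(X z $ 1, X z $ 3) \<in> K" for z
    proof (rule ccontr)
      assume "\<not> Im z \<ge> level m"
      then obtain k where k: "k \<ge> m" "real k - 2 \<le> cos (level k) * X z $ 3 - sin (level k) * X z $ 1"
        using near[OF z(1)] by force
      have "\<bar>X z $ 1\<bar> \<le> R" "\<bar>X z $ 3\<bar> \<le> R"
        using R[OF z(2)] norm_fst_le[of "X z $ 1" "X z $ 3"] norm_snd_le[of "X z $ 3" "X z $ 1"] by auto
      then have "\<bar>cos (level k) * X z $ 3\<bar> \<le> 1 * R" "\<bar>sin (level k) * X z $ 1\<bar> \<le> 1 * R"
        unfolding abs_mult by (intro mult_mono; simp)+
      then show False using k m by linarith
    qed
    then have "half_disc \<inter> (\<lambda>z. (X z $ 1, X z $ 3)) -` K = C \<inter> (\<lambda>z. (X z $ 1, X z $ 3)) -` K"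
      by (auto simp: C_def)
    also have "compact \<dots>"
    proof -
      have "continuous_on C (\<lambda>z. (X z $ 1, X z $ 3))"
        by (rule continuous_on_subset[OF cont]) (auto simp: C_def)
      then have "closed (C \<inter> (\<lambda>z. (X z $ 1, X z $ 3)) -` K)"
        by (rule continuous_closed_preimage) (use C K in \<open>auto intro: compact_imp_closed\<close>)
      then have "compact (C \<inter> (C \<inter> (\<lambda>z. (X z $ 1, X z $ 3)) -` K))" by (rule compact_Int_closed[OF C])
      then show ?thesis by simp
    qed
    finally show "compact (half_disc \<inter> (\<lambda>z. (X z $ 1, X z $ 3)) -` K)" .
  qed
  moreover have "(\<lambda>n. min (X (p n) $ 3 / (\<bar>X (p n) $ 1\<bar> + 1)) 0) \<longlonglongrightarrow> 0"
    if p: "divergent_in half_disc p" for p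
    unfolding tendsto_iff
  proof (intro allI impI)
    have pn: "p n \<in> half_disc" for n using p by (simp add: divergent_in_def)
    fix e :: real assume e: "e > 0"
    have "(\<lambda>k. level k) \<longlonglongrightarrow> 0" unfolding level_def
      using LIMSEQ_inverse_real_of_nat by (simp add: inverse_eq_divide)
    then have "(\<lambda>k. tan (level k)) \<longlonglongrightarrow> tan 0" by (rule isCont_tendsto_compose[OF isCont_tan, rotated]) simp
    then have "eventually (\<lambda>k. tan (level k) < e) sequentially"
      using e by (intro order_tendstoD(2)) auto
    then obtain m0 where m0: "\<And>k. k \<ge> m0 \<Longrightarrow> tan (level k) < e"
      by (auto simp: eventually_sequentially)
    \<comment> \<open>The 2 makes the bound \<open>k - 2\<close> on the height nonnegative.\<close>
    define m where "m = max m0 2"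
    define C where "C = half_disc \<inter> {z. level m \<le> Im z}"
    have "compact C" "C \<subseteq> half_disc"
      unfolding C_def by (auto intro: compact_half_disc_above[OF level(1)])
    then have "\<forall>\<^sub>F n in sequentially. p n \<notin> C"
      using p by (simp add: divergent_in_def)
    then show "\<forall>\<^sub>F n in sequentially. dist (min (X (p n) $ 3 / (\<bar>X (p n) $ 1\<bar> + 1)) 0) 0 < e"
    proof eventually_elim
      case (elim n)
      define x where "x = X (p n) $ 1"
      define y where "y = X (p n) $ 3"
      have "Im (p n) < level m" using elim pn[of n] by (auto simp: C_def)
      then obtain k where k: "k \<ge> m" "real k - 2 \<le> cos (level k) * y - sin (level k) * x"
        using near[OF pn] unfolding x_def y_def by blast
      have "real k \<ge> 2" "tan (level k) < e" using k m0[of k] by (auto simp: m_def)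
      \<comment> \<open>Division by the positive cosine will turn this into
        \<open>y \<ge> - tan (level k) * \<bar>x\<bar>\<close>, and the tangent is below
        \<open>e\<close>.\<close>
      then have "sin (level k) * x \<le> cos (level k) * y" using k by linarith
      moreover have "sin (level k) * (- \<bar>x\<bar>) \<le> sin (level k) * x"
        by (intro mult_left_mono sin_level_nonneg) auto
      ultimately have "cos (level k) * y \<ge> cos (level k) * (- tan (level k) * \<bar>x\<bar>)"
        using cos_level_pos[of k] by (simp add: tan_def)
      then have "y \<ge> - tan (level k) * \<bar>x\<bar>" using cos_level_pos[of k] by (simp only: mult_le_cancel_left_pos)
      moreover have "tan (level k) * \<bar>x\<bar> \<le> e * \<bar>x\<bar>" using \<open>tan (level k) < e\<close> by (intro mult_right_mono) auto
      ultimately have "y > - e * (\<bar>x\<bar> + 1)" using e by (simp add: algebra_simps)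
      then have "y / (\<bar>x\<bar> + 1) > - e" by (simp add: pos_less_divide_eq)
      then show ?case using e unfolding x_def[symmetric] y_def[symmetric] by (auto simp: dist_real_def min_def)
    qed
  qed
  ultimately show ?thesis by blast
qed

end
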